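(* Let $-\infty<a<b<+\infty$ and $I=[a,b]$. Let $f\in C(I\times[0,+\infty),\mathbb R)$ satisfy $f(t,0)=0$ for all $t\in I$, and let $\beta\in C(I,[0,+\infty))$ be such that $f(t,s)\ge-\beta(t)s$ for all $(t,s)\in I\times[0,+\infty)$. Assume the following two conditions. (i) There exist $\sigma>0$ and $b_0\in C(I,[0,+\infty))$, $b_0\not\equiv0$, such that $\lambda_1(b_0)<1$ and $$f(t,s)+\beta(t)s\ge b_0(t)s\qquad\text{for all }(t,s)\in I\times[0,\sigma].$$ (ii) There exist $\eta>0$ and $b_\infty\in C(I,[0,+\infty))$, $b_\infty\not\equiv0$, such that $\mu_1(b_\infty)>1$ and $$f(t,s)\le b_\infty(t)s\qquad\text{for all }(t,s)\in I\times[\eta,+\infty).$$ Then the problem $$-\left(\frac{u'(t)}{\sqrt{1-(u'(t))^2}}\right)'=f(t,u(t)),\quad t\in(a,b),\qquad u'(a)=0,\quad u(b)=0,$$ has at least one positive solution $u$, and $\|u'\|_\infty<1$.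
   Context: $\|\cdot\|_\infty$ is the maximum norm on $I=[a,b]$. Let $\varphi(s)=s/\sqrt{1-s^2}$ for $|s|<1$. A solution of the boundary value problem is a function $u\in C^1(I)$ such that $\|u'\|_\infty<1$, $\varphi(u')\in C^1(I)$, and the equation and boundary conditions hold. It is called positive if $u(t)>0$ for $a\le t<b$ and $u(b)=0$. For $c\in C(I,[0,+\infty))$, $c\not\equiv0$, $\lambda_1(c)$ denotes the principal (smallest) eigenvalue $\lambda$ of $$-e''+\beta(t)e=\lambda c(t)e\ \text{ on }(a,b),\qquad e'(a)=0,\quad e(b)=0,$$ where $\beta$ is the fixed function in the claim; equivalently, $$\lambda_1(c)=\inf\left\{\frac{\int_a^b\bigl((v')^2+\beta v^2\bigr)\,dt}{\int_a^b c\,v^2\,dt}:\ v\in H^1(a,b),\ v(b)=0,\ \int_a^b c\,v^2\,dt>0\right\}.$$ $\mu_1(c)$ denotes the principal eigenvalue of the same problem with $\beta$ replaced by $0$, i.e. of $-e''=\mu c(t)e$ on $(a,b)$, $e'(a)=0$, $e(b)=0$ (equivalently, the same infimum with $\beta\equiv0$). *)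

theory Defs
  imports "HOL-Analysis.Analysis"
begin

text \<open>
  Functions on \<open>I = [a,b]\<close> are total functions \<open>real \<Rightarrow> real\<close> of which only the values on \<open>I\<close>
  matter; accordingly derivatives are taken relative to \<open>I\<close>, hence one-sided at \<open>a\<close> and \<open>b\<close>.
\<close>

definition deriv_on :: "real \<Rightarrow> real \<Rightarrow> (real \<Rightarrow> real) \<Rightarrow> real \<Rightarrow> real" where
  "deriv_on a b u t = vector_derivative u (at t within {a..b})"

definition C1_on :: "real \<Rightarrow> real \<Rightarrow> (real \<Rightarrow> real) \<Rightarrow> bool" where
  "C1_on a b u \<longleftrightarrow> u differentiable_on {a..b} \<and> continuous_on {a..b} (deriv_on a b u)"

text \<open>Only meaningful for functions bounded on \<open>I\<close>, in particular for continuous ones.\<close>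

definition max_norm :: "real \<Rightarrow> real \<Rightarrow> (real \<Rightarrow> real) \<Rightarrow> real" where
  "max_norm a b v = (SUP t\<in>{a..b}. \<bar>v t\<bar>)"

definition phi :: "real \<Rightarrow> real" where
  "phi s = s / sqrt (1 - s\<^sup>2)"

definition bvp_solution ::
  "real \<Rightarrow> real \<Rightarrow> (real \<Rightarrow> real \<Rightarrow> real) \<Rightarrow> (real \<Rightarrow> real) \<Rightarrow> bool" where
  "bvp_solution a b f u \<longleftrightarrow>
     C1_on a b u \<and> max_norm a b (deriv_on a b u) < 1 \<and>
     C1_on a b (\<lambda>t. phi (deriv_on a b u t)) \<and>
     (\<forall>t\<in>{a<..<b}. - deriv_on a b (\<lambda>t. phi (deriv_on a b u t)) t = f t (u t)) \<and>
     deriv_on a b u a = 0 \<and> u b = 0"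

definition positive_on :: "real \<Rightarrow> real \<Rightarrow> (real \<Rightarrow> real) \<Rightarrow> bool" where
  "positive_on a b u \<longleftrightarrow> (\<forall>t\<in>{a..<b}. u t > 0) \<and> u b = 0"

text \<open>\<open>l\<close> is an eigenvalue of \<open>- e'' + \<beta> e = l c e\<close> on \<open>(a,b)\<close>, \<open>e'(a) = 0\<close>, \<open>e(b) = 0\<close>.\<close>

definition eigenvalue ::
  "real \<Rightarrow> real \<Rightarrow> (real \<Rightarrow> real) \<Rightarrow> (real \<Rightarrow> real) \<Rightarrow> real \<Rightarrow> bool" where
  "eigenvalue a b \<beta> c l \<longleftrightarrow>
     (\<exists>e. C1_on a b e \<and> (\<exists>t\<in>{a..b}. e t \<noteq> 0) \<and>
       (\<forall>t\<in>{a<..<b}. \<exists>e2. (deriv_on a b e has_real_derivative e2) (at t) \<and>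
          - e2 + \<beta> t * e t = l * c t * e t) \<and>
       deriv_on a b e a = 0 \<and> e b = 0)"

text \<open>
  For continuous \<open>\<beta>, c \<ge> 0\<close> on \<open>[a,b]\<close> with \<open>c\<close> not identically zero the problem is self-adjoint,
  so restricting to real eigenvalues loses nothing, and a smallest eigenvalue exists.
\<close>

definition principal_eigenvalue ::
  "real \<Rightarrow> real \<Rightarrow> (real \<Rightarrow> real) \<Rightarrow> (real \<Rightarrow> real) \<Rightarrow> real" where
  "principal_eigenvalue a b \<beta> c = (LEAST l. eigenvalue a b \<beta> c l)"

definition nonneg_continuous_on :: "real \<Rightarrow> real \<Rightarrow> (real \<Rightarrow> real) \<Rightarrow> bool" where
  "nonneg_continuous_on a b c \<longleftrightarrow> continuous_on {a..b} c \<and> (\<forall>t\<in>{a..b}. c t \<ge> 0)"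

end

theory Submission
  imports Defs "HOL-Complex_Analysis.Great_Picard"
begin

text \<open>
  The inverse of \<open>phi\<close> takes values in \<open>(-1, 1)\<close>, so every solution has slope below \<open>1\<close> and therefore
  stays below \<open>b - a\<close>. Hence an upper bound comes for free, and only a positive lower solution is
  needed to keep the solution away from \<open>0\<close>.

  The lower solution is a small multiple \<open>\<alpha>\<close> of the principal eigenfunction of the linear problem with
  weight \<open>b0\<close> (\<open>lower_solution_exists\<close>). The principal eigenvalue is defined as the least eigenvalue;
  that a least one exists and has an eigenfunction that is positive on \<open>[a, b)\<close> has to be shown
  (\<open>principal_eigenfunction\<close>). This is done by following the solutions of the linear initial value
  problem in the spectral parameter until they first acquire a zero.

  Replacing \<open>f(t, s)\<close> by its value at \<open>s\<close> truncated to \<open>[\<alpha>(t), b - a]\<close> gives a bounded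
  continuous right-hand side, for which the boundary value problem is solvable
  (\<open>bounded_bvp_solvable\<close>). As \<open>f\<close> is merely continuous, the initial value problem may lack uniqueness,
  and a direct shooting argument is not available; instead the equation is solved with a delay, where
  solutions are unique and depend continuously on the initial value, shooting is done there, and the
  delay is sent to \<open>0\<close> by the Arzela-Ascoli theorem. The same approximation also gives existence for
  the linear initial value problem.

  Finally a comparison argument (\<open>lower_solution_below\<close>) shows that the solution of the truncated
  problem lies above \<open>\<alpha>\<close>, hence solves the original problem and is positive.
\<close>

section \<open>Twofold integration and superposition\<close>

text \<open>
  \<open>twice_integral a \<Phi> h t\<close> is \<open>\<integral>\<^sub>a\<^sup>t \<Phi> (\<integral>\<^sub>a\<^sup>s h(r) dr) ds\<close>. A function \<open>u\<close> with
  \<open>u t = d - twice_integral a \<Phi> (\<lambda>r. g r (u r)) t\<close> satisfies \<open>- (\<Phi>\<^sup>-\<^sup>1(u'))' = g(t, u)\<close>,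
  \<open>u(a) = d\<close>, \<open>u'(a) = 0\<close>, for odd invertible \<open>\<Phi>\<close>. The identity yields linear equations and the
  inverse of \<open>phi\<close> the nonlinear problem.
\<close>

definition twice_integral :: "real \<Rightarrow> (real \<Rightarrow> real) \<Rightarrow> (real \<Rightarrow> real) \<Rightarrow> real \<Rightarrow> real" where
  "twice_integral a \<Phi> h t = integral {a..t} (\<lambda>s. \<Phi> (integral {a..s} h))"

lemma twice_integral_left [simp]: "twice_integral a \<Phi> h a = 0"
  by (simp add: twice_integral_def)

lemma twice_integral_cong:
  assumes "\<And>r. r \<in> {a..t} \<Longrightarrow> h r = k r"
  shows "twice_integral a \<Phi> h t = twice_integral a \<Phi> k t"
  unfolding twice_integral_def
proof (rule integral_cong)
  fix s assume "s \<in> {a..t}"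
  then have "integral {a..s} h = integral {a..s} k"
    using assms by (intro integral_cong) auto
  then show "\<Phi> (integral {a..s} h) = \<Phi> (integral {a..s} k)" by simp
qed

lemma continuous_on_integral_comp:
  fixes h \<Phi> :: "real \<Rightarrow> real"
  assumes "continuous_on {a..b} h" "continuous_on UNIV \<Phi>"
  shows "continuous_on {a..b} (\<lambda>s. \<Phi> (integral {a..s} h))"
  by (rule continuous_on_compose2[OF assms(2)])
    (use assms(1) in \<open>auto intro: indefinite_integral_continuous_1 integrable_continuous_interval\<close>)

lemma twice_integral_has_derivative:
  assumes "continuous_on {a..b} h" "continuous_on UNIV \<Phi>" "t \<in> {a..b}"
  shows "(twice_integral a \<Phi> h has_real_derivative \<Phi> (integral {a..t} h)) (at t within {a..b})"
  unfolding twice_integral_def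
  by (rule integral_has_real_derivative[OF continuous_on_integral_comp[OF assms(1,2)] assms(3)])

lemma continuous_on_twice_integral:
  assumes "continuous_on {a..b} h" "continuous_on UNIV \<Phi>"
  shows "continuous_on {a..b} (twice_integral a \<Phi> h)"
  using twice_integral_has_derivative[OF assms]
  by (intro DERIV_continuous_on) auto

lemma abs_integral_le:
  fixes h :: "real \<Rightarrow> real"
  assumes "continuous_on {a..b} h" "\<And>r. r \<in> {a..b} \<Longrightarrow> \<bar>h r\<bar> \<le> G" "s \<in> {a..b}"
  shows "\<bar>integral {a..s} h\<bar> \<le> G * (b - a)"
proof -
  have "\<bar>integral {a..s} h\<bar> \<le> G * (s - a)"
    using integral_bound[of a s h G] continuous_on_subset[OF assms(1), of "{a..s}"] assms(2,3) by auto
  also have "\<dots> \<le> G * (b - a)"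
    using assms(2)[of s] assms(3) by (intro mult_left_mono) auto
  finally show ?thesis .
qed

lemma twice_integral_lipschitz:
  assumes "continuous_on {a..b} h" "continuous_on UNIV \<Phi>" "\<And>w. \<bar>\<Phi> w\<bar> \<le> \<bar>w\<bar>"
    and "\<And>r. r \<in> {a..b} \<Longrightarrow> \<bar>h r\<bar> \<le> G" "s \<in> {a..b}" "t \<in> {a..b}"
  shows "\<bar>twice_integral a \<Phi> h s - twice_integral a \<Phi> h t\<bar> \<le> G * (b - a) * \<bar>s - t\<bar>"
proof -
  have "\<bar>\<Phi> (integral {a..z} h)\<bar> \<le> G * (b - a)" if "z \<in> {a..b}" for z
    using assms(3) abs_integral_le[OF assms(1,4) that] by (meson order_trans)
  then show ?thesis
    using field_differentiable_bound[of "{a..b}" "twice_integral a \<Phi> h"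
        "\<lambda>z. \<Phi> (integral {a..z} h)" "G * (b - a)" s t]
      twice_integral_has_derivative[OF assms(1,2)] assms(5,6) by auto
qed

lemma tendsto_twice_integral:
  assumes h: "\<And>n. continuous_on {a..b} (h n)" and \<Phi>: "continuous_on UNIV \<Phi>" "\<And>w. \<bar>\<Phi> w\<bar> \<le> \<bar>w\<bar>"
    and G: "\<And>n r. r \<in> {a..b} \<Longrightarrow> \<bar>h n r\<bar> \<le> G"
    and lim: "\<And>r. r \<in> {a..b} \<Longrightarrow> (\<lambda>n. h n r) \<longlonglongrightarrow> k r" and t: "t \<in> {a..b}"
  shows "(\<lambda>n. twice_integral a \<Phi> (h n) t) \<longlonglongrightarrow> twice_integral a \<Phi> k t"
  unfolding twice_integral_def
proof (rule dominated_convergence(2)[where h = "\<lambda>s. G * (b - a)"])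
  show "(\<lambda>s. \<Phi> (integral {a..s} (h n))) integrable_on {a..t}" for n
    by (rule integrable_continuous_interval, rule continuous_on_subset)
      (use t in \<open>auto intro!: continuous_on_integral_comp[OF h \<Phi>(1)]\<close>)
  show "(\<lambda>s. G * (b - a)) integrable_on {a..t}" by auto
  fix s assume s: "s \<in> {a..t}"
  then have s': "s \<in> {a..b}" using t by auto
  show "norm (\<Phi> (integral {a..s} (h n))) \<le> G * (b - a)" for n
    using abs_integral_le[OF h G s'] \<Phi>(2) by (metis order_trans real_norm_def)
  have "(\<lambda>n. integral {a..s} (h n)) \<longlonglongrightarrow> integral {a..s} k"
  proof (rule dominated_convergence(2)[where h = "\<lambda>s. G"])
    show "h n integrable_on {a..s}" for n
      by (rule integrable_continuous_interval, rule continuous_on_subset[OF h]) (use s' in auto)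
  qed (use G lim s' in auto)
  then show "(\<lambda>n. \<Phi> (integral {a..s} (h n))) \<longlonglongrightarrow> \<Phi> (integral {a..s} k)"
    by (rule continuous_on_tendsto_compose[OF \<Phi>(1)]) auto
qed

lemma continuous_on_superposition:
  fixes g :: "real \<Rightarrow> real \<Rightarrow> real"
  assumes "continuous_on ({a..b} \<times> UNIV) (\<lambda>(t, s). g t s)" "continuous_on {a..b} v"
  shows "continuous_on {a..b} (\<lambda>t. g t (v t))"
proof -
  have "continuous_on {a..b} (\<lambda>t. (\<lambda>(t, s). g t s) (t, v t))"
    by (rule continuous_on_compose2[OF assms(1)]) (use assms(2) in \<open>auto intro!: continuous_intros\<close>)
  then show ?thesis by simp
qed

lemma tendsto_superposition:
  fixes g :: "real \<Rightarrow> real \<Rightarrow> real"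
  assumes "continuous_on ({a..b} \<times> UNIV) (\<lambda>(t, s). g t s)" "t \<in> {a..b}" "v \<longlonglongrightarrow> l"
  shows "(\<lambda>n. g t (v n)) \<longlonglongrightarrow> g t l"
proof -
  have "(\<lambda>n. (t, v n)) \<longlonglongrightarrow> (t, l)" using assms(3) by (intro tendsto_intros)
  then show ?thesis
    using continuous_on_tendsto_compose[OF assms(1), of "\<lambda>n. (t, v n)" "(t, l)" sequentially] assms(2)
    by simp
qed

lemma continuous_on_delay:
  fixes v :: "real \<Rightarrow> real"
  assumes "continuous_on {a..b} v" "\<delta> \<ge> 0"
  shows "continuous_on {a..b} (\<lambda>r. v (max a (r - \<delta>)))"
  by (rule continuous_on_compose2[OF assms(1)]) (use assms(2) in \<open>auto intro!: continuous_intros\<close>)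

section \<open>Existence by delay approximation\<close>

text \<open>
  Picard iterates, started at the constant \<open>d\<close>, of the delayed equation in which \<open>u r\<close> is replaced by
  \<open>u (max a (r - \<delta>))\<close> inside the nonlinearity. By induction the \<open>k\<close>-th iterate is already final on
  \<open>[a, a + k \<delta>]\<close>, so finitely many steps solve the delayed equation on \<open>[a, b]\<close>. A Lipschitz
  condition on the nonlinearity is not needed.
\<close>

primrec delay_iter ::
  "real \<Rightarrow> (real \<Rightarrow> real) \<Rightarrow> (real \<Rightarrow> real \<Rightarrow> real) \<Rightarrow> real \<Rightarrow> nat \<Rightarrow> real \<Rightarrow> real \<Rightarrow> real" where
  "delay_iter a \<Phi> g \<delta> 0 d = (\<lambda>t. d)"
| "delay_iter a \<Phi> g \<delta> (Suc k) d =
     (\<lambda>t. d - twice_integral a \<Phi> (\<lambda>r. g r (delay_iter a \<Phi> g \<delta> k d (max a (r - \<delta>)))) t)"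

lemma continuous_on_delay_iter:
  assumes "continuous_on ({a..b} \<times> UNIV) (\<lambda>(t, s). g t s)" "continuous_on UNIV \<Phi>" "\<delta> \<ge> 0"
  shows "continuous_on {a..b} (delay_iter a \<Phi> g \<delta> k d)"
proof (induction k)
  case (Suc k)
  show ?case
    by (auto intro!: continuous_on_diff continuous_on_twice_integral[OF _ assms(2)]
        continuous_on_superposition[OF assms(1)] continuous_on_delay[OF Suc assms(3)])
qed auto

lemma delay_iter_stable:
  assumes "\<delta> \<ge> 0" "t \<in> {a..a + real k * \<delta>}"
  shows "delay_iter a \<Phi> g \<delta> (Suc k) d t = delay_iter a \<Phi> g \<delta> k d t"
  using assms(2)
proof (induction k arbitrary: t)
  case 0
  then have "t = a" by auto
  then show ?case by simp
next
  case (Suc k)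
  have eq: "delay_iter a \<Phi> g \<delta> (Suc k) d (max a (r - \<delta>)) = delay_iter a \<Phi> g \<delta> k d (max a (r - \<delta>))"
    if "r \<in> {a..t}" for r
    by (rule Suc.IH) (use that Suc.prems assms(1) in \<open>auto simp: algebra_simps\<close>)
  have "twice_integral a \<Phi> (\<lambda>r. g r (delay_iter a \<Phi> g \<delta> (Suc k) d (max a (r - \<delta>)))) t
     = twice_integral a \<Phi> (\<lambda>r. g r (delay_iter a \<Phi> g \<delta> k d (max a (r - \<delta>)))) t"
    by (rule twice_integral_cong) (simp only: eq)
  then show ?case
    unfolding delay_iter.simps(2)[of _ _ _ _ "Suc k"] by simp
qed

text \<open>
  Continuous dependence on the initial value, which a shooting argument needs. It fails in general
  for the equation without delay, whose solutions need not be unique.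
\<close>

lemma continuous_delay_iter_initial:
  assumes g: "continuous_on ({a..b} \<times> UNIV) (\<lambda>(t, s). g t s)" "\<And>t s. t \<in> {a..b} \<Longrightarrow> \<bar>g t s\<bar> \<le> G"
    and \<Phi>: "continuous_on UNIV \<Phi>" "\<And>w. \<bar>\<Phi> w\<bar> \<le> \<bar>w\<bar>" and \<delta>: "\<delta> \<ge> 0" and t: "t \<in> {a..b}"
  shows "continuous_on UNIV (\<lambda>d. delay_iter a \<Phi> g \<delta> k d t)"
  using t
proof (induction k arbitrary: t)
  case (Suc k)
  show ?case
    unfolding continuous_on_sequentially comp_def delay_iter.simps
  proof (intro allI ballI impI, elim conjE, intro tendsto_diff tendsto_twice_integral[where G=G and b=b])
    fix x :: "nat \<Rightarrow> real" and d n r assume x: "x \<longlonglongrightarrow> d"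
    show "continuous_on {a..b} (\<lambda>r. g r (delay_iter a \<Phi> g \<delta> k (x n) (max a (r - \<delta>))))"
      by (intro continuous_on_superposition[OF g(1)] continuous_on_delay continuous_on_delay_iter g(1) \<Phi>(1) \<delta>)
    assume r: "r \<in> {a..b}"
    show "\<bar>g r (delay_iter a \<Phi> g \<delta> k (x n) (max a (r - \<delta>)))\<bar> \<le> G"
      using g(2) r by blast
    have "continuous_on UNIV (\<lambda>d. delay_iter a \<Phi> g \<delta> k d (max a (r - \<delta>)))"
      by (rule Suc.IH) (use r \<delta> in auto)
    then have "(\<lambda>n. delay_iter a \<Phi> g \<delta> k (x n) (max a (r - \<delta>))) \<longlonglongrightarrow> delay_iter a \<Phi> g \<delta> k d (max a (r - \<delta>))"
      by (rule continuous_on_tendsto_compose) (use x in auto)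
    then show "(\<lambda>n. g r (delay_iter a \<Phi> g \<delta> k (x n) (max a (r - \<delta>))))
        \<longlonglongrightarrow> g r (delay_iter a \<Phi> g \<delta> k d (max a (r - \<delta>)))"
      by (rule tendsto_superposition[OF g(1) r])
  qed (use \<Phi> Suc.prems in auto)
qed auto

lemma delayed_equation_solvable:
  assumes g: "continuous_on ({a..b} \<times> UNIV) (\<lambda>(t, s). g t s)" "\<And>t s. t \<in> {a..b} \<Longrightarrow> \<bar>g t s\<bar> \<le> G"
    and \<Phi>: "continuous_on UNIV \<Phi>" "\<And>w. \<bar>\<Phi> w\<bar> \<le> \<bar>w\<bar>" and \<delta>: "\<delta> > 0"
  obtains U :: "real \<Rightarrow> real \<Rightarrow> real" where
    "\<And>d. continuous_on {a..b} (U d)"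
    "\<And>d t. t \<in> {a..b} \<Longrightarrow> U d t = d - twice_integral a \<Phi> (\<lambda>r. g r (U d (max a (r - \<delta>)))) t"
    "\<And>t. t \<in> {a..b} \<Longrightarrow> continuous_on UNIV (\<lambda>d. U d t)"
proof -
  obtain k :: nat where "(b - a) / \<delta> < real k" using reals_Archimedean2 by blast
  then have k: "b - a \<le> real k * \<delta>" using \<delta> by (simp add: field_simps)
  show thesis
  proof (rule that[of "\<lambda>d. delay_iter a \<Phi> g \<delta> k d"])
    fix d t assume "t \<in> {a..b}"
    then have "t \<in> {a..a + real k * \<delta>}" using k by auto
    from delay_iter_stable[OF _ this, of \<Phi> g d] \<delta>
    show "delay_iter a \<Phi> g \<delta> k d t
      = d - twice_integral a \<Phi> (\<lambda>r. g r (delay_iter a \<Phi> g \<delta> k d (max a (r - \<delta>)))) t" by simp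
  qed (use assms continuous_on_delay_iter continuous_delay_iter_initial[OF g \<Phi>] in auto)
qed

text \<open>
  As the delays tend to \<open>0\<close>, the delayed solutions are equi-Lipschitz and bounded, and a limit along a
  subsequence solves the equation without delay. The last clause carries initial and boundary values
  over to the limit.
\<close>

lemma delayed_solutions_converge:
  assumes g: "continuous_on ({a..b} \<times> UNIV) (\<lambda>(t, s). g t s)" "\<And>t s. t \<in> {a..b} \<Longrightarrow> \<bar>g t s\<bar> \<le> G"
    and \<Phi>: "continuous_on UNIV \<Phi>" "\<And>w. \<bar>\<Phi> w\<bar> \<le> \<bar>w\<bar>" and ab: "a < b"
    and u: "\<And>n. continuous_on {a..b} (u n)"
    and eq: "\<And>n t. t \<in> {a..b} \<Longrightarrow> u n t = d n - twice_integral a \<Phi> (\<lambda>r. g r (u n (max a (r - \<delta> n)))) t"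
    and \<delta>: "\<And>n. \<delta> n \<ge> 0" "\<delta> \<longlonglongrightarrow> 0" and d: "\<And>n. \<bar>d n\<bar> \<le> B"
  shows "\<exists>v. continuous_on {a..b} v \<and>
    (\<forall>t\<in>{a..b}. v t = v a - twice_integral a \<Phi> (\<lambda>r. g r (v r)) t) \<and>
    (\<forall>t\<in>{a..b}. \<forall>c. (\<forall>n. u n t = c) \<longrightarrow> v t = c)"
proof -
  define L where "L = G * (b - a)"
  have G0: "G \<ge> 0" using g(2)[of a] ab by force
  then have L0: "L \<ge> 0" using ab by (simp add: L_def)
  have contg: "continuous_on {a..b} (\<lambda>r. g r (u n (max a (r - \<delta> n))))" for n
    by (intro continuous_on_superposition[OF g(1)] continuous_on_delay u \<delta>)
  have lip: "\<bar>u n s - u n t\<bar> \<le> L * \<bar>s - t\<bar>" if "s \<in> {a..b}" "t \<in> {a..b}" for n s t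
  proof -
    have "u n s - u n t = twice_integral a \<Phi> (\<lambda>r. g r (u n (max a (r - \<delta> n)))) t
        - twice_integral a \<Phi> (\<lambda>r. g r (u n (max a (r - \<delta> n)))) s"
      using eq[OF that(1), of n] eq[OF that(2), of n] by linarith
    then show ?thesis
      using twice_integral_lipschitz[OF contg \<Phi> g(2), of t s n] that
      by (simp add: L_def abs_minus_commute)
  qed
  have ua: "u n a = d n" for n using eq[of a n] ab by simp
  have bd: "norm (u n x) \<le> B + L * (b - a)" if "x \<in> {a..b}" for n x
  proof -
    have "\<bar>u n x - u n a\<bar> \<le> L * \<bar>x - a\<bar>" using lip[OF that, of a] ab by auto
    also have "\<dots> \<le> L * (b - a)" using that L0 by (intro mult_left_mono) auto
    finally show ?thesis using d[of n] ua[of n] by simp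
  qed
  have equi: "\<exists>e'>0. \<forall>n y. y \<in> {a..b} \<and> norm (x - y) < e' \<longrightarrow> norm (u n x - u n y) < e"
    if "x \<in> {a..b}" "0 < e" for x e
  proof (intro exI[of _ "e / (L + 1)"] conjI allI impI)
    show "0 < e / (L + 1)" using that L0 by simp
    fix n y assume y: "y \<in> {a..b} \<and> norm (x - y) < e / (L + 1)"
    then have "(L + 1) * \<bar>x - y\<bar> < e" using L0 by (simp add: field_simps)
    moreover have "L * \<bar>x - y\<bar> \<le> (L + 1) * \<bar>x - y\<bar>" by (intro mult_right_mono) auto
    ultimately show "norm (u n x - u n y) < e" using lip[OF that(1), of y n] y by simp
  qed
  obtain v k where v: "continuous_on {a..b} v" and k: "strict_mono (k :: nat \<Rightarrow> nat)"
    and unif: "\<And>e. 0 < e \<Longrightarrow> \<exists>N. \<forall>n x. n \<ge> N \<and> x \<in> {a..b} \<longrightarrow> norm (u (k n) x - v x) < e"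
    using Arzela_Ascoli[OF compact_Icc bd equi] by metis
  have lim: "(\<lambda>n. u (k n) t) \<longlonglongrightarrow> v t" if "t \<in> {a..b}" for t
    by (rule LIMSEQ_I) (use unif that in blast)
  have \<delta>k: "(\<lambda>n. \<delta> (k n)) \<longlonglongrightarrow> 0"
    using LIMSEQ_subseq_LIMSEQ[OF \<delta>(2) k] by (simp add: comp_def)
  have limd: "(\<lambda>n. u (k n) (max a (r - \<delta> (k n)))) \<longlonglongrightarrow> v r" if r: "r \<in> {a..b}" for r
  proof -
    have "(\<lambda>n. u (k n) (max a (r - \<delta> (k n))) - u (k n) r) \<longlonglongrightarrow> 0"
    proof (rule tendsto_rabs_zero_cancel, rule tendsto_sandwich[OF always_eventually always_eventually])
      show "\<forall>n. 0 \<le> \<bar>u (k n) (max a (r - \<delta> (k n))) - u (k n) r\<bar>" by simp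
      show "\<forall>n. \<bar>u (k n) (max a (r - \<delta> (k n))) - u (k n) r\<bar> \<le> L * \<delta> (k n)"
      proof
        fix n
        have "\<bar>u (k n) (max a (r - \<delta> (k n))) - u (k n) r\<bar> \<le> L * \<bar>max a (r - \<delta> (k n)) - r\<bar>"
          by (rule lip) (use r \<delta>(1)[of "k n"] in auto)
        also have "\<dots> \<le> L * \<delta> (k n)"
          using L0 r \<delta>(1)[of "k n"] by (intro mult_left_mono) auto
        finally show "\<bar>u (k n) (max a (r - \<delta> (k n))) - u (k n) r\<bar> \<le> L * \<delta> (k n)" .
      qed
      show "(\<lambda>n. L * \<delta> (k n)) \<longlonglongrightarrow> 0" using tendsto_mult[OF tendsto_const \<delta>k, of L] by simp
    qed simp
    from tendsto_add[OF this lim[OF r]] show ?thesis by simp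
  qed
  have "v t = v a - twice_integral a \<Phi> (\<lambda>r. g r (v r)) t" if t: "t \<in> {a..b}" for t
  proof -
    have "(\<lambda>n. d (k n)) \<longlonglongrightarrow> v a" using lim[of a] ab ua by simp
    moreover have "(\<lambda>n. twice_integral a \<Phi> (\<lambda>r. g r (u (k n) (max a (r - \<delta> (k n))))) t)
        \<longlonglongrightarrow> twice_integral a \<Phi> (\<lambda>r. g r (v r)) t"
      by (rule tendsto_twice_integral[OF contg \<Phi> g(2) tendsto_superposition[OF g(1) _ limd] t])
    ultimately have "(\<lambda>n. u (k n) t) \<longlonglongrightarrow> v a - twice_integral a \<Phi> (\<lambda>r. g r (v r)) t"
      unfolding eq[OF t] by (rule tendsto_diff)
    then show ?thesis using lim[OF t] LIMSEQ_unique by blast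
  qed
  moreover have "v t = c" if "t \<in> {a..b}" "\<forall>n. u n t = c" for t c
    using lim[OF that(1)] that(2) by (simp add: LIMSEQ_const_iff)
  ultimately show ?thesis using v by (intro exI[of _ v]) blast
qed

lemma bounded_ivp_solvable:
  assumes g: "continuous_on ({a..b} \<times> UNIV) (\<lambda>(t, s). g t s)" "\<And>t s. t \<in> {a..b} \<Longrightarrow> \<bar>g t s\<bar> \<le> G"
    and \<Phi>: "continuous_on UNIV \<Phi>" "\<And>w. \<bar>\<Phi> w\<bar> \<le> \<bar>w\<bar>" and ab: "a < b"
  shows "\<exists>v. continuous_on {a..b} v \<and>
    (\<forall>t\<in>{a..b}. v t = d - twice_integral a \<Phi> (\<lambda>r. g r (v r)) t)"
proof -
  define Q where "Q n u \<longleftrightarrow> continuous_on {a..b} u \<and>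
    (\<forall>t\<in>{a..b}. u t = d - twice_integral a \<Phi> (\<lambda>r. g r (u (max a (r - inverse (real (Suc n)))))) t)"
    for n u
  have "\<exists>u. Q n u" for n
  proof -
    define \<delta> where "\<delta> = inverse (real (Suc n))"
    have \<delta>: "\<delta> > 0" by (simp add: \<delta>_def)
    obtain U where U: "\<And>d. continuous_on {a..b} (U d)"
      "\<And>d t. t \<in> {a..b} \<Longrightarrow> U d t = d - twice_integral a \<Phi> (\<lambda>r. g r (U d (max a (r - \<delta>)))) t"
      using delayed_equation_solvable[OF g \<Phi> \<delta>] by metis
    show ?thesis
      unfolding Q_def \<delta>_def[symmetric] using U by (intro exI[of _ "U d"]) auto
  qed
  then obtain u where "\<And>n. Q n (u n)" by metis
  then have u: "\<And>n. continuous_on {a..b} (u n)"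
    "\<And>n t. t\<in>{a..b} \<Longrightarrow> u n t = d - twice_integral a \<Phi> (\<lambda>r. g r (u n (max a (r - inverse (real (Suc n)))))) t"
    unfolding Q_def by blast+
  have inv: "0 \<le> inverse (real (Suc n))" for n by simp
  obtain v where v: "continuous_on {a..b} v \<and>
    (\<forall>t\<in>{a..b}. v t = v a - twice_integral a \<Phi> (\<lambda>r. g r (v r)) t) \<and>
    (\<forall>t\<in>{a..b}. \<forall>c. (\<forall>n. u n t = c) \<longrightarrow> v t = c)"
    using delayed_solutions_converge[OF g \<Phi> ab u inv LIMSEQ_inverse_real_of_nat order_refl] ..
  have "u n a = d" for n using u(2)[of a n] ab by simp
  moreover have "a \<in> {a..b}" using ab by simp
  ultimately have "v a = d" using v by blast
  show ?thesis using v unfolding \<open>v a = d\<close> by blast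
qed

text \<open>
  Shooting from the left end: at delay \<open>\<delta>\<close> the value at \<open>b\<close> depends continuously on the value \<open>d\<close> at
  \<open>a\<close> and differs from \<open>d\<close> by at most \<open>G (b - a)\<^sup>2\<close>, so it vanishes for some \<open>d\<close> of modulus at most
  that bound.
\<close>

lemma bounded_bvp_solvable:
  assumes g: "continuous_on ({a..b} \<times> UNIV) (\<lambda>(t, s). g t s)" "\<And>t s. t \<in> {a..b} \<Longrightarrow> \<bar>g t s\<bar> \<le> G"
    and \<Phi>: "continuous_on UNIV \<Phi>" "\<And>w. \<bar>\<Phi> w\<bar> \<le> \<bar>w\<bar>" and ab: "a < b"
  shows "\<exists>v. continuous_on {a..b} v \<and> v b = 0 \<and>
    (\<forall>t\<in>{a..b}. v t = v a - twice_integral a \<Phi> (\<lambda>r. g r (v r)) t)"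
proof -
  define B where "B = G * (b - a) * (b - a)"
  have G0: "G \<ge> 0" using g(2)[of a] ab by force
  then have B0: "B \<ge> 0" using ab by (simp add: B_def)
  define Q where "Q n d u \<longleftrightarrow> \<bar>d\<bar> \<le> B \<and> u b = 0 \<and> continuous_on {a..b} u \<and>
    (\<forall>t\<in>{a..b}. u t = d - twice_integral a \<Phi> (\<lambda>r. g r (u (max a (r - inverse (real (Suc n)))))) t)"
    for n d u
  have "\<exists>d u. Q n d u" for n
  proof -
    define \<delta> where "\<delta> = inverse (real (Suc n))"
    have \<delta>: "\<delta> > 0" by (simp add: \<delta>_def)
    obtain U where U: "\<And>d. continuous_on {a..b} (U d)"
      "\<And>d t. t \<in> {a..b} \<Longrightarrow> U d t = d - twice_integral a \<Phi> (\<lambda>r. g r (U d (max a (r - \<delta>)))) t"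
      "\<And>t. t \<in> {a..b} \<Longrightarrow> continuous_on UNIV (\<lambda>d. U d t)"
      using delayed_equation_solvable[OF g \<Phi> \<delta>] by metis
    have cont: "continuous_on {a..b} (\<lambda>r. g r (U d (max a (r - \<delta>))))" for d
      by (intro continuous_on_superposition[OF g(1)] continuous_on_delay U) (use \<delta> in auto)
    have bd: "\<bar>U d b - d\<bar> \<le> B" for d
      using twice_integral_lipschitz[OF cont \<Phi> g(2), of b a d] ab U(2)[of b d] by (simp add: B_def)
    have "U (- B) b \<le> 0" "0 \<le> U B b" using bd[of B] bd[of "- B"] by auto
    moreover have "continuous_on {- B..B} (\<lambda>d. U d b)"
      by (rule continuous_on_subset[OF U(3)]) (use ab in auto)
    ultimately obtain d where "- B \<le> d" "d \<le> B" "U d b = 0"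
      using IVT'[of "\<lambda>d. U d b" "- B" 0 B] B0 by auto
    then show ?thesis
      unfolding Q_def \<delta>_def[symmetric] using U by (intro exI[of _ d] exI[of _ "U d"]) auto
  qed
  then obtain d u where "\<And>n. Q n (d n) (u n)" by metis
  then have u: "\<And>n. \<bar>d n\<bar> \<le> B" "\<And>n. u n b = 0" "\<And>n. continuous_on {a..b} (u n)"
    "\<And>n t. t\<in>{a..b} \<Longrightarrow> u n t = d n - twice_integral a \<Phi> (\<lambda>r. g r (u n (max a (r - inverse (real (Suc n)))))) t"
    unfolding Q_def by blast+
  have inv: "0 \<le> inverse (real (Suc n))" for n by simp
  obtain v where v: "continuous_on {a..b} v \<and>
    (\<forall>t\<in>{a..b}. v t = v a - twice_integral a \<Phi> (\<lambda>r. g r (v r)) t) \<and>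
    (\<forall>t\<in>{a..b}. \<forall>c. (\<forall>n. u n t = c) \<longrightarrow> v t = c)"
    using delayed_solutions_converge[OF g \<Phi> ab u(3,4) inv LIMSEQ_inverse_real_of_nat u(1)] ..
  have "b \<in> {a..b}" using ab by simp
  then have "v b = 0" using v u(2) by blast
  then show ?thesis using v by blast
qed

section \<open>Linear second order initial value problems\<close>

lemma nondecreasing_of_deriv:
  fixes f :: "real \<Rightarrow> real"
  assumes "\<And>x. x \<in> {a..b} \<Longrightarrow> (f has_real_derivative f' x) (at x within {a..b})"
    and "a \<le> p" "p \<le> q" "q \<le> b" "\<And>x. p < x \<Longrightarrow> x < q \<Longrightarrow> 0 \<le> f' x"
  shows "f p \<le> f q"
proof (rule DERIV_nonneg_imp_increasing_open[OF assms(3)])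
  show "\<exists>y. (f has_real_derivative y) (at x) \<and> 0 \<le> y" if "p < x" "x < q" for x
    using assms(1)[of x] assms(2,4) assms(5)[OF that] that at_within_Icc_at[of a x b] by auto
  have "continuous_on {a..b} f" by (rule DERIV_continuous_on) (use assms(1) in auto)
  then show "continuous_on {p..q} f"
    by (rule continuous_on_subset) (use assms in auto)
qed

text \<open>
  The initial value problem \<open>- y'' = q y\<close>, \<open>y(a) = d\<close>, \<open>y'(a) = 0\<close> in integrated form.
\<close>

definition ivp_solution ::
  "real \<Rightarrow> real \<Rightarrow> (real \<Rightarrow> real) \<Rightarrow> real \<Rightarrow> (real \<Rightarrow> real) \<Rightarrow> bool" where
  "ivp_solution a b q d y \<longleftrightarrow> continuous_on {a..b} y \<and>
     (\<forall>t\<in>{a..b}. y t = d - twice_integral a (\<lambda>w. w) (\<lambda>r. q r * y r) t)"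

lemma ivp_solution_initial: "ivp_solution a b q d y \<Longrightarrow> a \<le> b \<Longrightarrow> y a = d"
  by (simp add: ivp_solution_def)

lemma twice_integral_add:
  fixes h1 h2 :: "real \<Rightarrow> real"
  assumes "continuous_on {a..b} h1" "continuous_on {a..b} h2" "t \<in> {a..b}"
  shows "twice_integral a (\<lambda>w. w) (\<lambda>r. h1 r + h2 r) t
    = twice_integral a (\<lambda>w. w) h1 t + twice_integral a (\<lambda>w. w) h2 t"
proof -
  have int: "h1 integrable_on {a..s}" "h2 integrable_on {a..s}" if "s \<in> {a..b}" for s
    using that assms by (auto intro!: integrable_continuous_interval elim: continuous_on_subset)
  have cont: "continuous_on {a..t} (\<lambda>s. integral {a..s} h1)" "continuous_on {a..t} (\<lambda>s. integral {a..s} h2)"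
    using int[OF assms(3)] by (auto intro: indefinite_integral_continuous_1)
  have "twice_integral a (\<lambda>w. w) (\<lambda>r. h1 r + h2 r) t
      = integral {a..t} (\<lambda>s. integral {a..s} h1 + integral {a..s} h2)"
    unfolding twice_integral_def
    by (rule integral_cong) (use int assms(3) in \<open>auto intro!: integral_add\<close>)
  also have "\<dots> = twice_integral a (\<lambda>w. w) h1 t + twice_integral a (\<lambda>w. w) h2 t"
    unfolding twice_integral_def using cont by (intro integral_add integrable_continuous_interval)
  finally show ?thesis .
qed

lemma abs_integral_le_exp:
  fixes h :: "real \<Rightarrow> real"
  assumes "continuous_on {a..s} h" "\<And>r. r \<in> {a..s} \<Longrightarrow> \<bar>h r\<bar> \<le> D * exp (K * (r - a))"
    and "0 \<le> D" "0 < K" "a \<le> s"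
  shows "\<bar>integral {a..s} h\<bar> \<le> D / K * exp (K * (s - a))"
proof -
  have int: "((\<lambda>r. D * exp (K * (r - a))) has_integral
      (D / K * exp (K * (s - a)) - D / K * exp (K * (a - a)))) {a..s}"
    by (rule fundamental_theorem_of_calculus[OF assms(5)],
        subst has_real_derivative_iff_has_vector_derivative[symmetric])
      (use assms(4) in \<open>auto intro!: derivative_eq_intros\<close>)
  have "\<bar>integral {a..s} h\<bar> \<le> integral {a..s} (\<lambda>r. D * exp (K * (r - a)))"
    using integral_norm_bound_integral[of h "{a..s}" "\<lambda>r. D * exp (K * (r - a))"]
      integrable_continuous_interval[OF assms(1)] int assms(2) by auto
  also have "\<dots> = D / K * exp (K * (s - a)) - D / K" using integral_unique[OF int] by simp
  also have "\<dots> \<le> D / K * exp (K * (s - a))" using assms(3,4) by simp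
  finally show ?thesis .
qed

text \<open>
  A Gronwall bound: in the maximum norm weighted with \<open>exp (- K (t - a))\<close>, the twofold integral of a
  function dominated by \<open>C \<bar>z\<bar>\<close> is at most \<open>C / K\<^sup>2\<close> times the norm of \<open>z\<close>, and this factor is at
  most \<open>1 / 2\<close> for \<open>K = 2 C + 1\<close>.
\<close>

lemma gronwall_twice_integral:
  fixes z h :: "real \<Rightarrow> real"
  assumes z: "continuous_on {a..b} z" and h: "continuous_on {a..b} h"
    and hz: "\<And>r. r \<in> {a..b} \<Longrightarrow> \<bar>h r\<bar> \<le> C * \<bar>z r\<bar>"
    and le: "\<And>t. t \<in> {a..b} \<Longrightarrow> \<bar>z t\<bar> \<le> A + \<bar>twice_integral a (\<lambda>w. w) h t\<bar>"
    and C: "0 \<le> C" and A: "0 \<le> A" and t: "t \<in> {a..b}"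
  shows "\<bar>z t\<bar> \<le> 2 * A * exp ((2 * C + 1) * (b - a))"
proof -
  define K where "K = 2 * C + 1"
  have K: "K > 0" using C by (simp add: K_def)
  have "continuous_on {a..b} (\<lambda>t. \<bar>z t\<bar> * exp (- K * (t - a)))"
    by (intro continuous_intros z)
  then obtain t0 where t0: "t0 \<in> {a..b}"
    and max: "\<And>t. t \<in> {a..b} \<Longrightarrow> \<bar>z t\<bar> * exp (- K * (t - a)) \<le> \<bar>z t0\<bar> * exp (- K * (t0 - a))"
    using continuous_attains_sup[of "{a..b}" "\<lambda>t. \<bar>z t\<bar> * exp (- K * (t - a))"] t by auto
  define M where "M = \<bar>z t0\<bar> * exp (- K * (t0 - a))"
  have M0: "M \<ge> 0" by (simp add: M_def)
  have zM: "\<bar>z r\<bar> \<le> M * exp (K * (r - a))" if "r \<in> {a..b}" for r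
  proof -
    have "\<bar>z r\<bar> = \<bar>z r\<bar> * exp (- K * (r - a)) * exp (K * (r - a))"
      by (simp add: mult.assoc flip: exp_add)
    also have "\<dots> \<le> M * exp (K * (r - a))"
      using max[OF that] unfolding M_def by (rule mult_right_mono) simp
    finally show ?thesis .
  qed
  have b1: "\<bar>integral {a..s} h\<bar> \<le> C * M / K * exp (K * (s - a))" if s: "s \<in> {a..b}" for s
  proof (rule abs_integral_le_exp)
    show "continuous_on {a..s} h" using h s by (auto elim: continuous_on_subset)
    fix r assume "r \<in> {a..s}"
    then have r: "r \<in> {a..b}" using s by auto
    have "\<bar>h r\<bar> \<le> C * \<bar>z r\<bar>" using hz r by blast
    also have "\<dots> \<le> C * (M * exp (K * (r - a)))" using zM[OF r] C by (rule mult_left_mono)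
    finally show "\<bar>h r\<bar> \<le> C * M * exp (K * (r - a))" by simp
  qed (use C M0 K s in auto)
  have b2: "\<bar>twice_integral a (\<lambda>w. w) h t0\<bar> \<le> C * M / K / K * exp (K * (t0 - a))"
    unfolding twice_integral_def
  proof (rule abs_integral_le_exp)
    show "continuous_on {a..t0} (\<lambda>s. integral {a..s} h)"
      using continuous_on_subset[OF h, of "{a..t0}"] t0
      by (intro indefinite_integral_continuous_1 integrable_continuous_interval) auto
  qed (use C M0 K t0 b1 in auto)
  have "C \<le> K * K / 2" using C by (simp add: K_def algebra_simps)
  then have "C * M / K / K \<le> M / 2"
    using K M0 mult_right_mono[of C "K * K / 2" M] by (simp add: field_simps)
  then have "C * M / K / K * exp (K * (t0 - a)) \<le> M / 2 * exp (K * (t0 - a))"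
    by (rule mult_right_mono) simp
  then have "\<bar>z t0\<bar> \<le> A + M / 2 * exp (K * (t0 - a))" using le[OF t0] b2 by linarith
  then have "\<bar>z t0\<bar> * exp (- K * (t0 - a)) \<le> (A + M / 2 * exp (K * (t0 - a))) * exp (- K * (t0 - a))"
    by (rule mult_right_mono) simp
  also have "\<dots> = A * exp (- K * (t0 - a)) + M / 2"
    by (simp add: algebra_simps exp_minus flip: exp_add)
  also have "\<dots> \<le> A * 1 + M / 2"
    using A K t0 by (intro add_right_mono mult_left_mono) auto
  finally have "M \<le> 2 * A" unfolding M_def[symmetric] by simp
  have "\<bar>z t\<bar> \<le> M * exp (K * (t - a))" by (rule zM[OF t])
  also have "\<dots> \<le> 2 * A * exp (K * (b - a))"
    using \<open>M \<le> 2 * A\<close> M0 K t by (intro mult_mono) auto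
  finally show ?thesis by (simp add: K_def)
qed

text \<open>
  The existence theorem for bounded nonlinearities is applied to \<open>q(t) cl(s)\<close>, where \<open>cl\<close> truncates at
  the a priori bound of the Gronwall lemma, so that the truncation is not active on the solution.
\<close>

lemma ivp_solution_exists:
  assumes q: "continuous_on {a..b} q" and C: "\<And>t. t \<in> {a..b} \<Longrightarrow> \<bar>q t\<bar> \<le> C" and ab: "a < b"
  shows "\<exists>y. ivp_solution a b q 1 y"
proof -
  have C0: "0 \<le> C" using C[of a] ab by auto
  define B where "B = 2 * exp ((2 * C + 1) * (b - a))"
  have B0: "B > 0" by (simp add: B_def)
  define cl where "cl s = max (- B) (min B s)" for s
  have cl_le: "\<bar>cl s\<bar> \<le> \<bar>s\<bar>" "\<bar>cl s\<bar> \<le> B" for s using B0 by (auto simp: cl_def)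
  define g where "g t s = q t * cl s" for t s
  have g: "continuous_on ({a..b} \<times> UNIV) (\<lambda>(t, s). g t s)"
    unfolding g_def cl_def case_prod_unfold
    by (intro continuous_intros continuous_on_compose2[OF q]) auto
  have gB: "\<bar>g t s\<bar> \<le> C * B" if "t \<in> {a..b}" for t s
    unfolding g_def abs_mult using C[OF that] cl_le(2) C0 by (intro mult_mono) auto
  obtain v where "continuous_on {a..b} v \<and>
    (\<forall>t\<in>{a..b}. v t = 1 - twice_integral a (\<lambda>w. w) (\<lambda>r. g r (v r)) t)"
    using bounded_ivp_solvable[OF g gB continuous_on_id order_refl ab] ..
  then have v: "continuous_on {a..b} v"
    "\<And>t. t \<in> {a..b} \<Longrightarrow> v t = 1 - twice_integral a (\<lambda>w. w) (\<lambda>r. g r (v r)) t"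
    by blast+
  have vB: "\<bar>v t\<bar> \<le> B" if "t \<in> {a..b}" for t
  proof -
    have "\<bar>v t\<bar> \<le> 2 * 1 * exp ((2 * C + 1) * (b - a))"
    proof (rule gronwall_twice_integral[OF v(1) continuous_on_superposition[OF g v(1)] _ _ C0 _ that])
      show "\<bar>g r (v r)\<bar> \<le> C * \<bar>v r\<bar>" if "r \<in> {a..b}" for r
        unfolding g_def abs_mult using C[OF that] cl_le(1) C0 by (intro mult_mono) auto
      show "\<bar>v t\<bar> \<le> 1 + \<bar>twice_integral a (\<lambda>w. w) (\<lambda>r. g r (v r)) t\<bar>" if "t \<in> {a..b}" for t
        using v(2)[OF that] by linarith
    qed simp
    then show ?thesis by (simp add: B_def)
  qed
  have "twice_integral a (\<lambda>w. w) (\<lambda>r. g r (v r)) t = twice_integral a (\<lambda>w. w) (\<lambda>r. q r * v r) t"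
    if "t \<in> {a..b}" for t
  proof (rule twice_integral_cong)
    fix r assume "r \<in> {a..t}"
    then have "\<bar>v r\<bar> \<le> B" using vB that by auto
    then show "g r (v r) = q r * v r" by (auto simp: g_def cl_def)
  qed
  then have "ivp_solution a b q 1 v" unfolding ivp_solution_def using v by simp
  then show ?thesis by (intro exI[of _ v])
qed

text \<open>
  Dependence on the coefficient and the initial value. With equal data it gives uniqueness.
\<close>

lemma ivp_solution_dependence:
  assumes y1: "ivp_solution a b q1 d1 y1" and y2: "ivp_solution a b q2 d2 y2"
    and q1: "continuous_on {a..b} q1" and q2: "continuous_on {a..b} q2"
    and C: "\<And>t. t \<in> {a..b} \<Longrightarrow> \<bar>q1 t\<bar> \<le> C"
    and B: "\<And>t. t \<in> {a..b} \<Longrightarrow> \<bar>(q1 t - q2 t) * y2 t\<bar> \<le> B"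
    and t: "t \<in> {a..b}"
  shows "\<bar>y1 t - y2 t\<bar> \<le> 2 * (\<bar>d1 - d2\<bar> + B * (b - a) * (b - a)) * exp ((2 * C + 1) * (b - a))"
proof -
  let ?T = "twice_integral a (\<lambda>w. w)"
  have c: "continuous_on {a..b} y1" "continuous_on {a..b} y2"
    using y1 y2 by (auto simp: ivp_solution_def)
  define z where "z t = y1 t - y2 t" for t
  have cz: "continuous_on {a..b} z" unfolding z_def by (intro continuous_intros c)
  have ch: "continuous_on {a..b} (\<lambda>r. q1 r * z r)" by (intro continuous_intros q1 cz)
  have ck: "continuous_on {a..b} (\<lambda>r. (q1 r - q2 r) * y2 r)" by (intro continuous_intros q1 q2 c)
  have c2: "continuous_on {a..b} (\<lambda>r. q2 r * y2 r)" by (intro continuous_intros q2 c)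
  have c12: "continuous_on {a..b} (\<lambda>r. q1 r * z r + (q1 r - q2 r) * y2 r)" by (intro continuous_intros ch ck)
  have "\<bar>z t\<bar> \<le> (\<bar>d1 - d2\<bar> + B * (b - a) * (b - a)) + \<bar>?T (\<lambda>r. q1 r * z r) t\<bar>" if t: "t \<in> {a..b}" for t
  proof -
    have eq: "(\<lambda>r. q1 r * y1 r) = (\<lambda>r. (q1 r * z r + (q1 r - q2 r) * y2 r) + q2 r * y2 r)"
      by (auto simp: z_def algebra_simps)
    have "?T (\<lambda>r. q1 r * y1 r) t = ?T (\<lambda>r. q1 r * z r) t + ?T (\<lambda>r. (q1 r - q2 r) * y2 r) t + ?T (\<lambda>r. q2 r * y2 r) t"
      unfolding eq twice_integral_add[OF c12 c2 t] twice_integral_add[OF ch ck t] ..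
    moreover have "y1 t = d1 - ?T (\<lambda>r. q1 r * y1 r) t" "y2 t = d2 - ?T (\<lambda>r. q2 r * y2 r) t"
      using y1 y2 t by (auto simp: ivp_solution_def)
    ultimately have "z t = (d1 - d2) - ?T (\<lambda>r. q1 r * z r) t - ?T (\<lambda>r. (q1 r - q2 r) * y2 r) t"
      unfolding z_def by linarith
    moreover have "\<bar>?T (\<lambda>r. (q1 r - q2 r) * y2 r) t\<bar> \<le> B * (b - a) * (b - a)"
    proof -
      have "\<bar>?T (\<lambda>r. (q1 r - q2 r) * y2 r) t\<bar> \<le> B * (b - a) * \<bar>t - a\<bar>"
        using twice_integral_lipschitz[OF ck continuous_on_id order_refl B t, of a] t by simp
      also have "\<dots> \<le> B * (b - a) * (b - a)"
        using B[OF t] t by (intro mult_left_mono) auto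
      finally show ?thesis .
    qed
    ultimately show ?thesis by linarith
  qed
  moreover have "\<bar>q1 r * z r\<bar> \<le> C * \<bar>z r\<bar>" if "r \<in> {a..b}" for r
    unfolding abs_mult using C[OF that] by (rule mult_right_mono) simp
  moreover have "0 \<le> C" "0 \<le> B" using C[OF t] B[OF t] by linarith+
  moreover have "0 \<le> \<bar>d1 - d2\<bar> + B * (b - a) * (b - a)"
    using \<open>0 \<le> B\<close> t by (intro add_nonneg_nonneg mult_nonneg_nonneg) auto
  ultimately have "\<bar>z t\<bar> \<le> 2 * (\<bar>d1 - d2\<bar> + B * (b - a) * (b - a)) * exp ((2 * C + 1) * (b - a))"
    using gronwall_twice_integral[OF cz ch _ _ _ _ t] by blast
  then show ?thesis by (simp add: z_def)
qed

lemma ivp_solution_derivs: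
  assumes y: "ivp_solution a b q d y" and q: "continuous_on {a..b} q" and ab: "a \<le> b"
  obtains p where "\<And>t. t \<in> {a..b} \<Longrightarrow> (y has_real_derivative p t) (at t within {a..b})"
    "\<And>t. t \<in> {a..b} \<Longrightarrow> (p has_real_derivative - (q t * y t)) (at t within {a..b})" "p a = 0"
proof (rule that[of "\<lambda>t. - integral {a..t} (\<lambda>r. q r * y r)"])
  have c: "continuous_on {a..b} (\<lambda>r. q r * y r)"
    using y q by (auto simp: ivp_solution_def intro: continuous_intros)
  show "(y has_real_derivative - integral {a..t} (\<lambda>r. q r * y r)) (at t within {a..b})"
    if t: "t \<in> {a..b}" for t
  proof (rule has_field_derivative_transform_within[OF _ zero_less_one t])
    show "d - twice_integral a (\<lambda>w. w) (\<lambda>r. q r * y r) s = y s" if "s \<in> {a..b}" for s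
      using y that by (auto simp: ivp_solution_def)
    show "((\<lambda>s. d - twice_integral a (\<lambda>w. w) (\<lambda>r. q r * y r) s) has_real_derivative
        - integral {a..t} (\<lambda>r. q r * y r)) (at t within {a..b})"
      using DERIV_diff[OF DERIV_const twice_integral_has_derivative[OF c continuous_on_id t]] by simp
  qed
  show "((\<lambda>t. - integral {a..t} (\<lambda>r. q r * y r)) has_real_derivative - (q t * y t)) (at t within {a..b})"
    if "t \<in> {a..b}" for t
    by (rule DERIV_minus[OF integral_has_real_derivative[OF c that]])
qed simp

lemma ivp_solution_of_derivs:
  assumes y: "\<And>t. t \<in> {a..b} \<Longrightarrow> (y has_real_derivative p t) (at t within {a..b})"
    and p: "continuous_on {a..b} p" "p a = 0"
    and dp: "\<And>t. t \<in> {a<..<b} \<Longrightarrow> (p has_real_derivative - (q t * y t)) (at t)"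
    and ab: "a < b"
  shows "ivp_solution a b q (y a) y"
  unfolding ivp_solution_def
proof (intro conjI ballI)
  show "continuous_on {a..b} y" by (rule DERIV_continuous_on) (use y in auto)
  fix t assume t: "t \<in> {a..b}"
  have 1: "integral {a..s} (\<lambda>r. q r * y r) = - p s" if s: "s \<in> {a..t}" for s
  proof -
    have "((\<lambda>r. - (q r * y r)) has_integral p s - p a) {a..s}"
    proof (rule fundamental_theorem_of_calculus_interior)
      show "continuous_on {a..s} p" using p(1) s t by (auto elim: continuous_on_subset)
      show "(p has_vector_derivative - (q x * y x)) (at x)" if "x \<in> {a<..<s}" for x
        using dp[of x] that s t has_real_derivative_iff_has_vector_derivative by auto
    qed (use s in auto)
    from has_integral_neg[OF this] show ?thesis using p(2) by (simp add: integral_unique)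
  qed
  have "(p has_integral y t - y a) {a..t}"
  proof (rule fundamental_theorem_of_calculus)
    show "(y has_vector_derivative p x) (at x within {a..t})" if "x \<in> {a..t}" for x
      unfolding has_real_derivative_iff_has_vector_derivative[symmetric]
      by (rule DERIV_subset[OF y]) (use that t in auto)
  qed (use t in auto)
  from integral_unique[OF has_integral_neg[OF this]] have "integral {a..t} (\<lambda>s. - p s) = y a - y t"
    by simp
  then show "y t = y a - twice_integral a (\<lambda>w. w) (\<lambda>r. q r * y r) t"
    unfolding twice_integral_def using integral_cong[of "{a..t}" "\<lambda>s. integral {a..s} (\<lambda>r. q r * y r)" "\<lambda>s. - p s"] 1
    by simp
qed

lemma deriv_on_eq:
  assumes "a < b" "t \<in> {a..b}" "(u has_real_derivative u') (at t within {a..b})"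
  shows "deriv_on a b u t = u'"
  unfolding deriv_on_def
  using vector_derivative_within_closed_interval[OF assms(1,2)] assms(3)
  by (simp add: has_real_derivative_iff_has_vector_derivative)

lemma C1_onI:
  assumes ab: "a < b" and u: "\<And>t. t \<in> {a..b} \<Longrightarrow> (u has_real_derivative p t) (at t within {a..b})"
    and p: "continuous_on {a..b} p"
  shows "C1_on a b u"
  unfolding C1_on_def
proof
  show "u differentiable_on {a..b}"
    using u unfolding differentiable_on_def real_differentiable_def by blast
  show "continuous_on {a..b} (deriv_on a b u)"
    using p by (rule continuous_on_eq) (use deriv_on_eq[OF ab _ u] in auto)
qed

lemma C1_on_has_derivative:
  assumes "C1_on a b u" "t \<in> {a..b}"
  shows "(u has_real_derivative deriv_on a b u t) (at t within {a..b})"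
proof -
  have "u differentiable (at t within {a..b})"
    using assms by (auto simp: C1_on_def differentiable_on_def)
  then show ?thesis
    unfolding deriv_on_def has_real_derivative_iff_has_vector_derivative
    by (simp add: vector_derivative_works)
qed

lemma eigenvalue_iff:
  assumes ab: "a < b" and \<beta>: "continuous_on {a..b} \<beta>" and c: "continuous_on {a..b} c"
  shows "eigenvalue a b \<beta> c l \<longleftrightarrow>
    (\<exists>e. ivp_solution a b (\<lambda>t. l * c t - \<beta> t) (e a) e \<and> (\<exists>t\<in>{a..b}. e t \<noteq> 0) \<and> e b = 0)"
    (is "_ \<longleftrightarrow> ?R")
proof
  assume "eigenvalue a b \<beta> c l"
  then obtain e where e: "C1_on a b e" "\<exists>t\<in>{a..b}. e t \<noteq> 0" "deriv_on a b e a = 0" "e b = 0"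
    and de: "\<And>t. t \<in> {a<..<b} \<Longrightarrow> \<exists>e2. (deriv_on a b e has_real_derivative e2) (at t) \<and>
          - e2 + \<beta> t * e t = l * c t * e t"
    unfolding eigenvalue_def by blast
  have "(deriv_on a b e has_real_derivative - ((l * c t - \<beta> t) * e t)) (at t)" if t: "t \<in> {a<..<b}" for t
  proof -
    obtain e2 where e2: "(deriv_on a b e has_real_derivative e2) (at t)"
        "- e2 + \<beta> t * e t = l * c t * e t" using de[OF t] by blast
    have "e2 = - ((l * c t - \<beta> t) * e t)" using e2(2) by (simp add: algebra_simps)
    then show ?thesis using e2(1) by simp
  qed
  then have "ivp_solution a b (\<lambda>t. l * c t - \<beta> t) (e a) e"
    using ivp_solution_of_derivs[OF C1_on_has_derivative[OF e(1)]] e(1,3) ab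
    by (auto simp: C1_on_def)
  then show ?R using e by blast
next
  assume ?R
  then obtain e where e: "ivp_solution a b (\<lambda>t. l * c t - \<beta> t) (e a) e" "\<exists>t\<in>{a..b}. e t \<noteq> 0" "e b = 0"
    by blast
  have "continuous_on {a..b} (\<lambda>t. l * c t - \<beta> t)" by (intro continuous_intros \<beta> c)
  then obtain p where p: "\<And>t. t \<in> {a..b} \<Longrightarrow> (e has_real_derivative p t) (at t within {a..b})"
    "\<And>t. t \<in> {a..b} \<Longrightarrow> (p has_real_derivative - ((l * c t - \<beta> t) * e t)) (at t within {a..b})" "p a = 0"
    using ivp_solution_derivs[OF e(1)] ab by (metis less_imp_le)
  have pc: "continuous_on {a..b} p" by (rule DERIV_continuous_on) (use p(2) in auto)
  note dp = deriv_on_eq[OF ab _ p(1)]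
  have "\<exists>e2. (deriv_on a b e has_real_derivative e2) (at t) \<and> - e2 + \<beta> t * e t = l * c t * e t"
    if t: "t \<in> {a<..<b}" for t
  proof (intro exI conjI)
    have "(p has_real_derivative - ((l * c t - \<beta> t) * e t)) (at t)"
      using p(2)[of t] t at_within_Icc_at[of a t b] by auto
    then show "(deriv_on a b e has_real_derivative - ((l * c t - \<beta> t) * e t)) (at t)"
      by (rule has_field_derivative_transform_within_open[of _ _ _ "{a<..<b}"]) (use t dp in auto)
  qed (simp add: algebra_simps)
  then show "eigenvalue a b \<beta> c l"
    unfolding eigenvalue_def using e C1_onI[OF ab p(1) pc] dp p(3) ab by (intro exI[of _ e]) auto
qed

section \<open>The principal eigenfunction\<close>

lemma nonneg_continuous_bound:
  assumes "nonneg_continuous_on a b c" "a \<le> b"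
  obtains M where "0 \<le> M" "\<And>t. t \<in> {a..b} \<Longrightarrow> \<bar>c t\<bar> \<le> M"
proof -
  have c: "continuous_on {a..b} c" "\<And>t. t \<in> {a..b} \<Longrightarrow> 0 \<le> c t"
    using assms(1) by (auto simp: nonneg_continuous_on_def)
  obtain x where "x \<in> {a..b}" "\<And>t. t \<in> {a..b} \<Longrightarrow> c t \<le> c x"
    using continuous_attains_sup[OF compact_Icc _ c(1)] assms(2) by auto
  with c(2) show thesis by (intro that[of "c x"]) auto
qed

lemma bounded_below_on_subinterval:
  assumes c: "nonneg_continuous_on a b c" and t0: "t0 \<in> {a..b}" "c t0 \<noteq> 0" and ab: "a < b"
  obtains p r c0 where "a \<le> p" "p < r" "r \<le> b" "0 < c0" "\<And>t. t \<in> {p..r} \<Longrightarrow> c0 \<le> c t"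
proof -
  have cc: "continuous_on {a..b} c" and "c t0 > 0"
    using c t0 by (auto simp: nonneg_continuous_on_def order_less_le)
  then obtain d where d: "d > 0" "\<And>t. t \<in> {a..b} \<Longrightarrow> dist t t0 < d \<Longrightarrow> dist (c t) (c t0) < c t0 / 2"
    using t0 unfolding continuous_on_iff by (metis half_gt_zero)
  show thesis
  proof (rule that[of "max a (t0 - d / 2)" "min b (t0 + d / 2)" "c t0 / 2"])
    fix t assume "t \<in> {max a (t0 - d / 2)..min b (t0 + d / 2)}"
    then have "t \<in> {a..b}" "dist t t0 < d" using d(1) by (auto simp: dist_real_def)
    from d(2)[OF this] show "c t0 / 2 \<le> c t" by (auto simp: dist_real_def abs_if split: if_splits)
  qed (use ab t0 d(1) \<open>c t0 > 0\<close> in auto)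
qed

text \<open>
  For \<open>q \<le> 0\<close> the function \<open>y y'\<close> is nondecreasing from \<open>0\<close>, hence \<open>y\<^sup>2\<close> is nondecreasing from \<open>1\<close>.
\<close>

lemma ivp_solution_nonzero_of_nonpos:
  assumes y: "ivp_solution a b q 1 y" and q: "continuous_on {a..b} q"
    and neg: "\<And>t. t \<in> {a..b} \<Longrightarrow> q t \<le> 0" and ab: "a < b" and t: "t \<in> {a..b}"
  shows "y t \<noteq> 0"
proof -
  obtain p where p: "\<And>t. t \<in> {a..b} \<Longrightarrow> (y has_real_derivative p t) (at t within {a..b})"
    "\<And>t. t \<in> {a..b} \<Longrightarrow> (p has_real_derivative - (q t * y t)) (at t within {a..b})" "p a = 0"
    using ivp_solution_derivs[OF y q] ab by (metis less_imp_le)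
  have ya: "y a = 1" using ivp_solution_initial[OF y] ab by simp
  have yp: "0 \<le> y s * p s" if s: "s \<in> {a..b}" for s
  proof -
    have "y a * p a \<le> y s * p s"
    proof (rule nondecreasing_of_deriv[where f = "\<lambda>t. y t * p t"])
      show "((\<lambda>t. y t * p t) has_real_derivative p x * p x + y x * - (q x * y x)) (at x within {a..b})"
        if "x \<in> {a..b}" for x
        using DERIV_mult[OF p(1)[OF that] p(2)[OF that]] by (simp add: algebra_simps)
      show "0 \<le> p x * p x + y x * - (q x * y x)" if "a < x" "x < s" for x
      proof -
        have "0 \<le> (- q x) * (y x * y x)"
          by (rule mult_nonneg_nonneg) (use neg[of x] that s in auto)
        moreover have "0 \<le> p x * p x" by simp
        moreover have "y x * - (q x * y x) = (- q x) * (y x * y x)" by simp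
        ultimately show ?thesis by linarith
      qed
    qed (use s in auto)
    then show ?thesis using p(3) by simp
  qed
  have "y a * y a \<le> y t * y t"
  proof (rule nondecreasing_of_deriv[where f = "\<lambda>t. y t * y t"])
    show "((\<lambda>t. y t * y t) has_real_derivative p x * y x + p x * y x) (at x within {a..b})"
      if "x \<in> {a..b}" for x
      using DERIV_mult[OF p(1)[OF that] p(1)[OF that]] by (simp add: algebra_simps)
    show "0 \<le> p x * y x + p x * y x" if "a < x" "x < t" for x
      using yp[of x] that t by (auto simp: mult.commute)
  qed (use t in auto)
  then show ?thesis using ya by auto
qed

text \<open>
  Sturm comparison with \<open>sin (k (t - p))\<close>, which vanishes at the ends of \<open>[p, r]\<close>: for a solution without
  zeros the Wronskian \<open>W\<close> would be nondecreasing, positive at \<open>p\<close> and negative at \<open>r\<close>.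
\<close>

lemma ivp_solution_oscillates:
  assumes y: "ivp_solution a b q 1 y" and q: "continuous_on {a..b} q"
    and pr: "a \<le> p" "p < r" "r \<le> b" and k: "k = pi / (r - p)"
    and large: "\<And>t. t \<in> {p..r} \<Longrightarrow> k\<^sup>2 \<le> q t"
  shows "\<exists>t\<in>{a..b}. y t = 0"
proof (rule ccontr)
  assume nz: "\<not> (\<exists>t\<in>{a..b}. y t = 0)"
  have ab: "a \<le> b" using pr by simp
  have ya: "y a = 1" using ivp_solution_initial[OF y ab] .
  have yc: "continuous_on {a..b} y" using y by (simp add: ivp_solution_def)
  have pos: "y t > 0" if t: "t \<in> {a..b}" for t
  proof (rule ccontr)
    assume "\<not> 0 < y t"
    then have "\<exists>s\<ge>a. s \<le> t \<and> y s = 0"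
      using t ya by (intro IVT2') (auto intro: continuous_on_subset[OF yc])
    then show False using nz t by auto
  qed
  obtain y' where y': "\<And>t. t \<in> {a..b} \<Longrightarrow> (y has_real_derivative y' t) (at t within {a..b})"
    "\<And>t. t \<in> {a..b} \<Longrightarrow> (y' has_real_derivative - (q t * y t)) (at t within {a..b})"
    using ivp_solution_derivs[OF y q ab] by metis
  have k0: "k > 0" using pr k by simp
  define W where "W t = y t * (k * cos (k * (t - p))) - y' t * sin (k * (t - p))" for t
  have "W p \<le> W r"
  proof (rule nondecreasing_of_deriv[where f = "W"])
    show "(W has_real_derivative y x * sin (k * (x - p)) * (q x - k\<^sup>2)) (at x within {a..b})"
      if "x \<in> {a..b}" for x
      unfolding W_def
      by (rule derivative_eq_intros y'[OF that] refl | simp add: algebra_simps power2_eq_square)+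
    show "0 \<le> y x * sin (k * (x - p)) * (q x - k\<^sup>2)" if "p < x" "x < r" for x
    proof (intro mult_nonneg_nonneg)
      have "k * (x - p) \<le> k * (r - p)" using that k0 by simp
      also have "\<dots> = pi" using pr k by simp
      finally show "0 \<le> sin (k * (x - p))" using that k0 by (intro sin_ge_zero) auto
      show "0 \<le> y x" using pos[of x] that pr by auto
      show "0 \<le> q x - k\<^sup>2" using large[of x] that by auto
    qed
  qed (use pr in auto)
  moreover have "W p = k * y p" by (simp add: W_def)
  moreover have "W r = - (k * y r)" using pr k by (simp add: W_def)
  moreover have "0 < k * y p" "0 < k * y r" using k0 pos pr by auto
  ultimately show False by linarith
qed

text \<open>
  The energy \<open>y\<^sup>2 + y'\<^sup>2\<close> decays at most exponentially, so it cannot reach \<open>0\<close>.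
\<close>

lemma ivp_solution_no_double_zero:
  assumes y: "ivp_solution a b q 1 y" and q: "continuous_on {a..b} q"
    and C: "\<And>t. t \<in> {a..b} \<Longrightarrow> \<bar>q t\<bar> \<le> C"
    and t: "t \<in> {a<..<b}" "y t = 0" "(y has_real_derivative 0) (at t)"
  shows False
proof -
  have ab: "a < b" using t by auto
  obtain p where p: "\<And>t. t \<in> {a..b} \<Longrightarrow> (y has_real_derivative p t) (at t within {a..b})"
    "\<And>t. t \<in> {a..b} \<Longrightarrow> (p has_real_derivative - (q t * y t)) (at t within {a..b})" "p a = 0"
    using ivp_solution_derivs[OF y q] ab by (metis less_imp_le)
  have ya: "y a = 1" using ivp_solution_initial[OF y] ab by simp
  have pt: "p t = 0"
    using p(1)[of t] t at_within_Icc_at[of a t b] DERIV_unique by fastforce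
  have "((y a)\<^sup>2 + (p a)\<^sup>2) * exp ((1 + C) * (a - a)) \<le> ((y t)\<^sup>2 + (p t)\<^sup>2) * exp ((1 + C) * (t - a))"
  proof (rule nondecreasing_of_deriv[where f = "\<lambda>x. ((y x)\<^sup>2 + (p x)\<^sup>2) * exp ((1 + C) * (x - a))"])
    show "((\<lambda>x. ((y x)\<^sup>2 + (p x)\<^sup>2) * exp ((1 + C) * (x - a))) has_real_derivative
        (2 * y x * p x * (1 - q x) + ((y x)\<^sup>2 + (p x)\<^sup>2) * (1 + C)) * exp ((1 + C) * (x - a))) (at x within {a..b})"
      if "x \<in> {a..b}" for x
      by (rule derivative_eq_intros p(1,2)[OF that] refl | simp add: algebra_simps)+
    show "0 \<le> (2 * y x * p x * (1 - q x) + ((y x)\<^sup>2 + (p x)\<^sup>2) * (1 + C)) * exp ((1 + C) * (x - a))"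
      if "a < x" "x < t" for x
    proof (rule mult_nonneg_nonneg)
      have "\<bar>1 - q x\<bar> \<le> 1 + C" using C[of x] that t by auto
      moreover have "\<bar>2 * y x * p x\<bar> \<le> (y x)\<^sup>2 + (p x)\<^sup>2"
        using sum_squares_bound[of "y x" "p x"] sum_squares_bound[of "- y x" "p x"] by auto
      ultimately have "\<bar>2 * y x * p x\<bar> * \<bar>1 - q x\<bar> \<le> ((y x)\<^sup>2 + (p x)\<^sup>2) * (1 + C)"
        by (intro mult_mono) auto
      then show "0 \<le> 2 * y x * p x * (1 - q x) + ((y x)\<^sup>2 + (p x)\<^sup>2) * (1 + C)"
        unfolding abs_mult[symmetric] by linarith
    qed simp
  qed (use t in auto)
  then show False using ya p(3) pt t by simp
qed

lemma deriv_zero_at_interior_min: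
  fixes v :: "real \<Rightarrow> real"
  assumes "(v has_real_derivative l) (at t within {a..b})" "t \<in> {a<..<b}"
    and "\<And>s. s \<in> {a..b} \<Longrightarrow> v t \<le> v s"
  shows "l = 0"
proof (rule DERIV_local_min)
  show "(v has_real_derivative l) (at t)"
    using assms(1,2) at_within_Icc_at[of a t b] by auto
  show "0 < min (t - a) (b - t)" using assms(2) by auto
  show "\<forall>s. \<bar>t - s\<bar> < min (t - a) (b - t) \<longrightarrow> v t \<le> v s"
    by (intro allI impI assms(3)) (auto simp: abs_less_iff)
qed

text \<open>
  Let \<open>Y l\<close> solve \<open>- y'' = (l c - \<beta>) y\<close>, \<open>y(a) = 1\<close>, \<open>y'(a) = 0\<close>, and let \<open>S\<close> be the set of those \<open>l\<close> for
  which \<open>Y l\<close> has a zero in \<open>[a, b]\<close>. Every eigenvalue lies in \<open>S\<close>. The infimum of \<open>S\<close> belongs to \<open>S\<close>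
  by continuity in \<open>l\<close>, the corresponding solution is a limit of positive functions and has no double
  zero, so its only zero is \<open>b\<close>. Hence this infimum is the least eigenvalue.
\<close>

lemma principal_eigenfunction:
  assumes ab: "a < b" and \<beta>: "nonneg_continuous_on a b \<beta>" and c: "nonneg_continuous_on a b c"
    and c0: "\<exists>t\<in>{a..b}. c t \<noteq> 0"
  obtains e where
    "ivp_solution a b (\<lambda>t. principal_eigenvalue a b \<beta> c * c t - \<beta> t) 1 e"
    "\<And>t. t \<in> {a..<b} \<Longrightarrow> e t > 0" "e b = 0"
proof -
  have cc: "continuous_on {a..b} c" "\<And>t. t \<in> {a..b} \<Longrightarrow> 0 \<le> c t"
    and cb: "continuous_on {a..b} \<beta>" "\<And>t. t \<in> {a..b} \<Longrightarrow> 0 \<le> \<beta> t"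
    using c \<beta> by (auto simp: nonneg_continuous_on_def)
  obtain Mc where Mc: "0 \<le> Mc" "\<And>t. t \<in> {a..b} \<Longrightarrow> \<bar>c t\<bar> \<le> Mc"
    using nonneg_continuous_bound[OF c] ab by (metis less_imp_le)
  obtain Mb where Mb: "0 \<le> Mb" "\<And>t. t \<in> {a..b} \<Longrightarrow> \<bar>\<beta> t\<bar> \<le> Mb"
    using nonneg_continuous_bound[OF \<beta>] ab by (metis less_imp_le)
  define q where "q l t = l * c t - \<beta> t" for l t
  have qc: "continuous_on {a..b} (q l)" for l unfolding q_def by (intro continuous_intros cc cb)
  have qb: "\<bar>q l t\<bar> \<le> \<bar>l\<bar> * Mc + Mb" if "t \<in> {a..b}" for l t
  proof -
    have "\<bar>q l t\<bar> \<le> \<bar>l\<bar> * \<bar>c t\<bar> + \<bar>\<beta> t\<bar>" unfolding q_def abs_mult[symmetric] by linarith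
    also have "\<dots> \<le> \<bar>l\<bar> * Mc + Mb" using Mc Mb that by (intro add_mono mult_left_mono) auto
    finally show ?thesis .
  qed
  have "\<forall>l. \<exists>y. ivp_solution a b (q l) 1 y" using ivp_solution_exists[OF qc qb ab] by blast
  then obtain Y where Y: "\<And>l. ivp_solution a b (q l) 1 (Y l)" by metis
  have Yc: "continuous_on {a..b} (Y l)" for l using Y by (simp add: ivp_solution_def)
  have Ya: "Y l a = 1" for l using ivp_solution_initial[OF Y] ab by simp

  have Ylim: "\<exists>\<delta>>0. \<forall>l t. \<bar>l - m\<bar> < \<delta> \<and> t \<in> {a..b} \<longrightarrow> \<bar>Y l t - Y m t\<bar> < \<epsilon>" if "\<epsilon> > 0" for m \<epsilon>
  proof -
    obtain B where B: "\<And>t. t \<in> {a..b} \<Longrightarrow> \<bar>Y m t\<bar> \<le> B"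
      using continuous_attains_sup[of "{a..b}" "\<lambda>t. \<bar>Y m t\<bar>"] ab continuous_on_rabs[OF Yc]
      by (metis atLeastAtMost_iff compact_Icc empty_iff less_imp_le order_refl)
    have B0: "B \<ge> 0" using B[of a] ab by auto
    \<comment> \<open>On \<open>\<bar>l - m\<bar> < 1\<close> the coefficients \<open>q l\<close> are uniformly bounded, so \<open>Y\<close> is Lipschitz in \<open>l\<close> there.\<close>
    define E where "E = exp ((2 * ((\<bar>m\<bar> + 1) * Mc + Mb) + 1) * (b - a))"
    define D where "D = 2 * (Mc * B * (b - a) * (b - a)) * E"
    have D0: "D \<ge> 0" using Mc(1) B0 ab unfolding D_def E_def by simp
    have le: "\<bar>Y l t - Y m t\<bar> \<le> \<bar>l - m\<bar> * D" if lm: "\<bar>l - m\<bar> < 1" and t: "t \<in> {a..b}" for l t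
    proof -
      have "\<bar>Y l t - Y m t\<bar> \<le> 2 * (\<bar>1 - 1\<bar> + \<bar>l - m\<bar> * Mc * B * (b - a) * (b - a)) * E"
        unfolding E_def
      proof (rule ivp_solution_dependence[OF Y Y qc qc _ _ t])
        fix s assume s: "s \<in> {a..b}"
        have "\<bar>l\<bar> * Mc \<le> (\<bar>m\<bar> + 1) * Mc" using lm Mc(1) by (intro mult_right_mono) auto
        then show "\<bar>q l s\<bar> \<le> (\<bar>m\<bar> + 1) * Mc + Mb" using qb[OF s, of l] by linarith
        have "q l s - q m s = (l - m) * c s" by (simp add: q_def algebra_simps)
        then have "\<bar>q l s - q m s\<bar> \<le> \<bar>l - m\<bar> * Mc"
          using Mc(2)[OF s] by (simp add: abs_mult mult_left_mono)
        then show "\<bar>(q l s - q m s) * Y m s\<bar> \<le> \<bar>l - m\<bar> * Mc * B"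
          unfolding abs_mult[of "q l s - q m s"] using B[OF s] Mc(1) by (intro mult_mono) auto
      qed
      then show ?thesis by (simp add: D_def algebra_simps)
    qed
    show ?thesis
    proof (intro exI conjI allI impI)
      show "0 < min 1 (\<epsilon> / (D + 1))" using \<open>\<epsilon> > 0\<close> D0 by simp
      fix l t assume lt: "\<bar>l - m\<bar> < min 1 (\<epsilon> / (D + 1)) \<and> t \<in> {a..b}"
      then have "\<bar>l - m\<bar> * (D + 1) < \<epsilon>" using D0 by (simp add: field_simps)
      moreover have "\<bar>l - m\<bar> * D \<le> \<bar>l - m\<bar> * (D + 1)" by (intro mult_left_mono) auto
      ultimately show "\<bar>Y l t - Y m t\<bar> < \<epsilon>" using le[of l t] lt by auto
    qed
  qed

  define S where "S = {l. \<exists>t\<in>{a..b}. Y l t = 0}"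
  have S_pos: "0 \<le> l" if l: "l \<in> S" for l
  proof (rule ccontr)
    assume "\<not> 0 \<le> l"
    then have "q l t \<le> 0" if "t \<in> {a..b}" for t
      using cc(2)[OF that] cb(2)[OF that] mult_nonpos_nonneg[of l "c t"] by (simp add: q_def)
    then show False
      using l ivp_solution_nonzero_of_nonpos[OF Y qc _ ab] by (auto simp: S_def)
  qed
  have "S \<noteq> {}"
  proof -
    obtain p r cm where pr: "a \<le> p" "p < r" "r \<le> b" and cm: "0 < cm" "\<And>t. t \<in> {p..r} \<Longrightarrow> cm \<le> c t"
      using bounded_below_on_subinterval[OF c _ _ ab] c0 by metis
    define k where "k = pi / (r - p)"
    define l where "l = (k\<^sup>2 + Mb) / cm"
    have l0: "0 \<le> l" using cm(1) Mb(1) by (simp add: l_def)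
    have "k\<^sup>2 \<le> q l t" if t: "t \<in> {p..r}" for t
    proof -
      have "l * cm \<le> l * c t" using cm(2)[OF t] l0 by (rule mult_left_mono)
      moreover have "l * cm = k\<^sup>2 + Mb" using cm(1) by (simp add: l_def)
      moreover have "\<beta> t \<le> Mb" using Mb(2)[of t] t pr by auto
      ultimately show ?thesis by (simp add: q_def)
    qed
    from ivp_solution_oscillates[OF Y qc pr k_def this] show ?thesis by (auto simp: S_def)
  qed
  define lam where "lam = Inf S"
  have bdd: "bdd_below S" using S_pos by (auto simp: bdd_below_def)
  have lower: "lam \<le> l" if "l \<in> S" for l unfolding lam_def using that bdd by (rule cInf_lower)
  have "lam \<in> S"
  proof (rule ccontr)
    assume "lam \<notin> S"
    obtain x where x: "x \<in> {a..b}" "\<And>t. t \<in> {a..b} \<Longrightarrow> \<bar>Y lam x\<bar> \<le> \<bar>Y lam t\<bar>"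
      using continuous_attains_inf[of "{a..b}" "\<lambda>t. \<bar>Y lam t\<bar>"] ab continuous_on_rabs[OF Yc] by auto
    have "\<bar>Y lam x\<bar> > 0" using \<open>lam \<notin> S\<close> x by (auto simp: S_def)
    from Ylim[OF this] obtain \<delta> where \<delta>: "\<delta> > 0"
      "\<And>l t. \<bar>l - lam\<bar> < \<delta> \<Longrightarrow> t \<in> {a..b} \<Longrightarrow> \<bar>Y l t - Y lam t\<bar> < \<bar>Y lam x\<bar>" by blast
    obtain l where l: "l \<in> S" "l < lam + \<delta>"
      using \<delta>(1) cInf_lessD[OF \<open>S \<noteq> {}\<close>, of "lam + \<delta>"] by (auto simp: lam_def)
    then obtain t where t: "t \<in> {a..b}" "Y l t = 0" by (auto simp: S_def)
    have "\<bar>Y l t - Y lam t\<bar> < \<bar>Y lam x\<bar>" using \<delta>(2)[of l t] t l lower[OF l(1)] by auto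
    then show False using x(2)[OF t(1)] t(2) by simp
  qed
  have nonneg: "0 \<le> Y lam t" if t: "t \<in> {a..b}" for t
  proof (rule ccontr)
    assume "\<not> 0 \<le> Y lam t"
    then have "- Y lam t > 0" by simp
    from Ylim[OF this] obtain \<delta> where \<delta>: "\<delta> > 0"
      "\<And>l t'. \<bar>l - lam\<bar> < \<delta> \<Longrightarrow> t' \<in> {a..b} \<Longrightarrow> \<bar>Y l t' - Y lam t'\<bar> < - Y lam t" by blast
    define l where "l = lam - \<delta> / 2"
    have "\<bar>Y l t - Y lam t\<bar> < - Y lam t" using \<delta>(1) t by (intro \<delta>(2)) (auto simp: l_def)
    then have "Y l t \<le> 0" by linarith
    then have "\<exists>s\<ge>a. s \<le> t \<and> Y l s = 0"
      using t Ya[of l] by (intro IVT2') (auto intro: continuous_on_subset[OF Yc])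
    then have "l \<in> S" using t by (auto simp: S_def)
    then show False using lower[of l] \<delta>(1) by (simp add: l_def)
  qed
  have pos: "0 < Y lam t" if t: "t \<in> {a..<b}" for t
  proof (rule ccontr)
    assume "\<not> 0 < Y lam t"
    then have t0: "Y lam t = 0" using nonneg[of t] t by auto
    then have ti: "t \<in> {a<..<b}" using t Ya[of lam] by (cases "t = a") auto
    obtain p where p: "\<And>t. t \<in> {a..b} \<Longrightarrow> (Y lam has_real_derivative p t) (at t within {a..b})"
      using ivp_solution_derivs[OF Y qc, of lam] ab by (metis less_imp_le)
    have "p t = 0"
      using t t0 nonneg by (intro deriv_zero_at_interior_min[OF p ti]) auto
    then have "(Y lam has_real_derivative 0) (at t)"
      using p[of t] ti at_within_Icc_at[of a t b] by auto
    then show False using ivp_solution_no_double_zero[OF Y qc qb ti t0] by blast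
  qed
  have Yb: "Y lam b = 0"
  proof -
    obtain t where t: "t \<in> {a..b}" "Y lam t = 0" using \<open>lam \<in> S\<close> by (auto simp: S_def)
    then have "t = b" using pos[of t] by (cases "t = b") auto
    then show ?thesis using t by simp
  qed
  have ev: "eigenvalue a b \<beta> c l \<longleftrightarrow>
    (\<exists>e. ivp_solution a b (q l) (e a) e \<and> (\<exists>t\<in>{a..b}. e t \<noteq> 0) \<and> e b = 0)" for l
    using eigenvalue_iff[OF ab cb(1) cc(1)] unfolding q_def .
  have "principal_eigenvalue a b \<beta> c = lam"
    unfolding principal_eigenvalue_def
  proof (rule Least_equality)
    show "eigenvalue a b \<beta> c lam"
      unfolding ev using Y[of lam] Ya[of lam] Yb ab by (intro exI[of _ "Y lam"]) force
    fix l assume "eigenvalue a b \<beta> c l"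
    then obtain e where e: "ivp_solution a b (q l) (e a) e" "\<exists>t\<in>{a..b}. e t \<noteq> 0" "e b = 0"
      unfolding ev by blast
    \<comment> \<open>By uniqueness every eigenfunction is a multiple of \<open>Y l\<close>.\<close>
    define z where "z t = e a * Y l t" for t
    have z: "ivp_solution a b (q l) (e a) z"
      unfolding ivp_solution_def
    proof (intro conjI ballI)
      show "continuous_on {a..b} z" unfolding z_def by (intro continuous_intros Yc)
      fix t assume t: "t \<in> {a..b}"
      have "twice_integral a (\<lambda>w. w) (\<lambda>r. q l r * z r) t = e a * twice_integral a (\<lambda>w. w) (\<lambda>r. q l r * Y l r) t"
        by (simp add: twice_integral_def z_def mult.left_commute)
      moreover have "Y l t = 1 - twice_integral a (\<lambda>w. w) (\<lambda>r. q l r * Y l r) t"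
        using Y[of l] t by (simp add: ivp_solution_def)
      ultimately show "z t = e a - twice_integral a (\<lambda>w. w) (\<lambda>r. q l r * z r) t"
        unfolding z_def by (simp add: right_diff_distrib)
    qed
    have ez: "e t = e a * Y l t" if t: "t \<in> {a..b}" for t
      using ivp_solution_dependence[OF e(1) z qc qc qb _ t, of 0] by (simp add: z_def)
    then have "e a \<noteq> 0" using e(2) by force
    then have "Y l b = 0" using ez[of b] e(3) ab by simp
    then show "lam \<le> l" using ab by (intro lower) (auto simp: S_def)
  qed
  then show thesis using that[of "Y lam"] Y[of lam] pos Yb unfolding q_def by simp
qed

section \<open>Positive solutions above a lower solution\<close>

text \<open>
  The inverse of \<open>phi\<close>, a homeomorphism from the real line onto the interval \<open>(-1, 1)\<close>.
\<close>

definition phi_inv :: "real \<Rightarrow> real" where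
  "phi_inv w = w / sqrt (1 + w\<^sup>2)"

lemma one_plus_square_pos: "0 < 1 + (w::real)\<^sup>2"
  by (simp add: add_pos_nonneg)

lemma continuous_on_phi_inv: "continuous_on UNIV phi_inv"
  unfolding phi_inv_def using one_plus_square_pos
  by (intro continuous_intros) (simp add: less_imp_neq[symmetric])

lemma abs_phi_inv_less_1: "\<bar>phi_inv w\<bar> < 1"
proof -
  have "\<bar>w\<bar> = sqrt (w\<^sup>2)" by simp
  also have "\<dots> < sqrt (1 + w\<^sup>2)" by (rule real_sqrt_less_mono) simp
  finally show ?thesis
    using one_plus_square_pos[of w] by (simp add: phi_inv_def abs_divide)
qed

lemma abs_phi_inv_le: "\<bar>phi_inv w\<bar> \<le> \<bar>w\<bar>"
proof -
  have "1 \<le> sqrt (1 + w\<^sup>2)" by simp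
  then have "\<bar>w\<bar> / sqrt (1 + w\<^sup>2) \<le> \<bar>w\<bar> / 1"
    using one_plus_square_pos[of w] by (intro divide_left_mono) auto
  then show ?thesis by (simp add: phi_inv_def abs_divide)
qed

lemma phi_phi_inv: "phi (phi_inv w) = w"
proof -
  have "1 - (phi_inv w)\<^sup>2 = 1 / (1 + w\<^sup>2)"
    using one_plus_square_pos[of w] by (simp add: phi_inv_def power_divide field_simps)
  then have "sqrt (1 - (phi_inv w)\<^sup>2) = 1 / sqrt (1 + w\<^sup>2)"
    by (simp add: real_sqrt_divide)
  then show ?thesis
    using one_plus_square_pos[of w] by (simp add: phi_def phi_inv_def)
qed

lemma phi_inv_minus: "phi_inv (- w) = - phi_inv w"
  by (simp add: phi_inv_def)

lemma one_minus_square_pos: "\<bar>s\<bar> < 1 \<Longrightarrow> 0 < 1 - (s::real)\<^sup>2"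
  by (simp add: abs_square_less_1)

lemma phi_has_derivative:
  assumes "\<bar>s\<bar> < 1"
  shows "(phi has_real_derivative 1 / (sqrt (1 - s\<^sup>2)) ^ 3) (at s)"
proof -
  define R where "R = sqrt (1 - s\<^sup>2)"
  have R: "R > 0" "R\<^sup>2 = 1 - s\<^sup>2"
    using one_minus_square_pos[OF assms] by (auto simp: R_def)
  have "(phi has_real_derivative (1 * R - s * (- (2 * s) * (inverse R / 2))) / (R * R)) (at s)"
    unfolding phi_def R_def using one_minus_square_pos[OF assms]
    by (auto intro!: derivative_eq_intros)
  moreover have "(1 * R - s * (- (2 * s) * (inverse R / 2))) / (R * R) = (R\<^sup>2 + s\<^sup>2) / R ^ 3"
    using R(1) by (simp add: field_simps power2_eq_square power3_eq_cube)
  moreover have "R\<^sup>2 + s\<^sup>2 = 1" using R(2) by simp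
  ultimately show ?thesis by (simp add: R_def)
qed

lemma phi_mono_iff:
  assumes "\<bar>s\<bar> < 1" "\<bar>t\<bar> < 1"
  shows "phi s \<le> phi t \<longleftrightarrow> s \<le> t"
proof -
  have strict: "phi x < phi y" if "\<bar>x\<bar> < 1" "\<bar>y\<bar> < 1" "x < y" for x y
  proof (rule DERIV_pos_imp_increasing[OF \<open>x < y\<close>])
    fix z assume z: "x \<le> z" "z \<le> y"
    then have "\<bar>z\<bar> < 1" using that by auto
    then show "\<exists>d. (phi has_real_derivative d) (at z) \<and> 0 < d"
      using phi_has_derivative[of z] one_minus_square_pos[of z] by auto
  qed
  show ?thesis using strict[OF assms] strict[OF assms(2,1)] by force
qed

lemma bvp_solution_of_fixed_point:
  assumes ab: "a < b" and h: "continuous_on {a..b} h"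
    and u: "\<And>t. t \<in> {a..b} \<Longrightarrow> u t = u a - twice_integral a phi_inv h t" and ub: "u b = 0"
    and hf: "\<And>t. t \<in> {a..b} \<Longrightarrow> h t = f t (u t)"
  shows "bvp_solution a b f u"
proof -
  define p where "p t = - phi_inv (integral {a..t} h)" for t
  have du: "(u has_real_derivative p t) (at t within {a..b})" if t: "t \<in> {a..b}" for t
  proof (rule has_field_derivative_transform_within[OF _ zero_less_one t])
    show "((\<lambda>s. u a - twice_integral a phi_inv h s) has_real_derivative p t) (at t within {a..b})"
      using DERIV_diff[OF DERIV_const twice_integral_has_derivative[OF h continuous_on_phi_inv t], of "u a"]
      by (simp add: p_def)
    show "u a - twice_integral a phi_inv h s = u s" if "s \<in> {a..b}" for s using u[OF that] by simp
  qed
  have pc: "continuous_on {a..b} p"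
    unfolding p_def by (intro continuous_on_minus continuous_on_integral_comp[OF h continuous_on_phi_inv])
  have p: "deriv_on a b u t = p t" if "t \<in> {a..b}" for t by (rule deriv_on_eq[OF ab that du[OF that]])
  have ph: "phi (p t) = - integral {a..t} h" for t
    using phi_phi_inv[of "- integral {a..t} h"] by (simp add: p_def phi_inv_minus)
  have dph: "((\<lambda>t. phi (deriv_on a b u t)) has_real_derivative - h t) (at t within {a..b})"
    if t: "t \<in> {a..b}" for t
  proof (rule has_field_derivative_transform_within[OF _ zero_less_one t])
    show "((\<lambda>s. - integral {a..s} h) has_real_derivative - h t) (at t within {a..b})"
      by (rule DERIV_minus[OF integral_has_real_derivative[OF h t]])
    show "- integral {a..s} h = phi (deriv_on a b u s)" if "s \<in> {a..b}" for s
      using p[OF that] ph by simp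
  qed
  obtain x where x: "x \<in> {a..b}" "\<And>t. t \<in> {a..b} \<Longrightarrow> \<bar>p t\<bar> \<le> \<bar>p x\<bar>"
    using continuous_attains_sup[of "{a..b}" "\<lambda>t. \<bar>p t\<bar>"] ab continuous_on_rabs[OF pc] by auto
  have "max_norm a b (deriv_on a b u) \<le> \<bar>p x\<bar>"
    unfolding max_norm_def using ab x(2) p by (intro cSUP_least) auto
  also have "\<dots> < 1" using abs_phi_inv_less_1 by (simp add: p_def)
  finally have "max_norm a b (deriv_on a b u) < 1" .
  moreover have "C1_on a b u" by (rule C1_onI[OF ab du pc])
  moreover have "C1_on a b (\<lambda>t. phi (deriv_on a b u t))"
    using C1_onI[OF ab dph] continuous_on_minus[OF h] by blast
  moreover have "- deriv_on a b (\<lambda>t. phi (deriv_on a b u t)) t = f t (u t)" if "t \<in> {a<..<b}" for t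
    using deriv_on_eq[OF ab _ dph, of t] hf[of t] that by auto
  moreover have "deriv_on a b u a = 0" using p[of a] ab by (simp add: p_def phi_inv_def)
  ultimately show ?thesis unfolding bvp_solution_def using ub by blast
qed

text \<open>
  Comparison with a lower solution \<open>\<alpha>\<close>; here \<open>w\<close> and \<open>z\<close> are the derivatives of \<open>phi(u')\<close> and
  \<open>phi(\<alpha>')\<close>. At a negative minimum of \<open>u - \<alpha>\<close> the slopes agree. As long as \<open>u - \<alpha>\<close> stays negative
  to the right of it, \<open>phi(u') - phi(\<alpha>')\<close> and hence \<open>u - \<alpha>\<close> are nonincreasing, so that \<open>u - \<alpha>\<close> cannot
  return to \<open>0\<close>.
\<close>

lemma lower_solution_below:
  assumes ab: "a < b"
    and u: "\<And>t. t \<in> {a..b} \<Longrightarrow> (u has_real_derivative u' t) (at t within {a..b})"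
    and \<alpha>: "\<And>t. t \<in> {a..b} \<Longrightarrow> (\<alpha> has_real_derivative \<alpha>' t) (at t within {a..b})"
    and lt1: "\<And>t. t \<in> {a..b} \<Longrightarrow> \<bar>u' t\<bar> < 1" "\<And>t. t \<in> {a..b} \<Longrightarrow> \<bar>\<alpha>' t\<bar> < 1"
    and w: "\<And>t. t \<in> {a..b} \<Longrightarrow> ((\<lambda>t. phi (u' t)) has_real_derivative w t) (at t within {a..b})"
    and z: "\<And>t. t \<in> {a..b} \<Longrightarrow> ((\<lambda>t. phi (\<alpha>' t)) has_real_derivative z t) (at t within {a..b})"
    and le: "\<And>t. t \<in> {a<..<b} \<Longrightarrow> u t < \<alpha> t \<Longrightarrow> w t \<le> z t"
    and bc: "u' a = \<alpha>' a" "\<alpha> b \<le> u b" and t: "t \<in> {a..b}"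
  shows "\<alpha> t \<le> u t"
proof (rule ccontr)
  assume neg: "\<not> \<alpha> t \<le> u t"
  define v where "v t = u t - \<alpha> t" for t
  have dv: "(v has_real_derivative u' t - \<alpha>' t) (at t within {a..b})" if "t \<in> {a..b}" for t
    unfolding v_def by (rule DERIV_diff[OF u[OF that] \<alpha>[OF that]])
  have vc: "continuous_on {a..b} v" by (rule DERIV_continuous_on) (use dv in auto)
  obtain t0 where t0: "t0 \<in> {a..b}" "\<And>t. t \<in> {a..b} \<Longrightarrow> v t0 \<le> v t"
    using continuous_attains_inf[of "{a..b}" v] ab vc by auto
  have v0: "v t0 < 0" using t0(2)[OF t] neg by (simp add: v_def)
  have t0b: "t0 < b" using v0 bc(2) t0(1) by (cases "t0 = b") (auto simp: v_def)
  have crit: "u' t0 = \<alpha>' t0"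
  proof (cases "t0 = a")
    case False
    then have "t0 \<in> {a<..<b}" using t0(1) t0b by auto
    from deriv_zero_at_interior_min[OF dv[OF t0(1)] this t0(2)] show ?thesis by simp
  qed (use bc in simp)
  \<comment> \<open>The first zero of \<open>u - \<alpha>\<close> to the right of the minimum.\<close>
  have "\<exists>t1\<ge>t0. t1 \<le> b \<and> v t1 = 0 \<and> (\<forall>t. t0 \<le> t \<and> t < t1 \<longrightarrow> v t < 0)"
  proof -
    have "continuous_on {t0..b} v" by (rule continuous_on_subset[OF vc]) (use t0(1) in auto)
    then have "closed {t\<in>{t0..b}. 0 \<le> v t}"
      by (intro continuous_on_closed_Collect_le continuous_on_const closed_real_atLeastAtMost)
    moreover have "bounded {t\<in>{t0..b}. 0 \<le> v t}"
      by (rule bounded_subset[OF bounded_closed_interval]) auto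
    ultimately have cl: "compact {t\<in>{t0..b}. 0 \<le> v t}" by (simp add: compact_eq_bounded_closed)
    have "b \<in> {t\<in>{t0..b}. 0 \<le> v t}" using bc(2) t0b by (simp add: v_def)
    then obtain t1 where t1: "t1 \<in> {t0..b}" "0 \<le> v t1" "\<And>t. t \<in> {t0..b} \<Longrightarrow> 0 \<le> v t \<Longrightarrow> t1 \<le> t"
      using compact_attains_inf[OF cl] by blast
    have "\<forall>t. t0 \<le> t \<and> t < t1 \<longrightarrow> v t < 0" using t1 by force
    moreover have "v t1 = 0"
    proof -
      obtain s where s: "t0 \<le> s" "s \<le> t1" "v s = 0"
        using v0 t1(1,2) t0(1) IVT'[of v t0 0 t1] continuous_on_subset[OF vc, of "{t0..t1}"] by auto
      then have "s = t1" using t1(1) t1(3)[of s] by auto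
      then show ?thesis using s by simp
    qed
    ultimately show ?thesis using t1(1) by auto
  qed
  then obtain t1 where t1: "t0 \<le> t1" "t1 \<le> b" "v t1 = 0" "\<And>t. t0 \<le> t \<Longrightarrow> t < t1 \<Longrightarrow> v t < 0"
    by blast
  have slope: "u' s \<le> \<alpha>' s" if s: "t0 \<le> s" "s \<le> t1" for s
  proof -
    have "phi (\<alpha>' t0) - phi (u' t0) \<le> phi (\<alpha>' s) - phi (u' s)"
    proof (rule nondecreasing_of_deriv[where f = "\<lambda>t. phi (\<alpha>' t) - phi (u' t)"])
      show "((\<lambda>t. phi (\<alpha>' t) - phi (u' t)) has_real_derivative z x - w x) (at x within {a..b})"
        if "x \<in> {a..b}" for x by (rule DERIV_diff[OF z[OF that] w[OF that]])
      show "0 \<le> z x - w x" if "t0 < x" "x < s" for x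
        using le[of x] t1(4)[of x] that s t0(1) t1(2) by (auto simp: v_def)
    qed (use s t0(1) t1(2) in auto)
    then have "phi (u' s) \<le> phi (\<alpha>' s)" using crit by simp
    then show ?thesis using phi_mono_iff lt1[of s] s t0(1) t1(2) by auto
  qed
  have "- v t0 \<le> - v t1"
  proof (rule nondecreasing_of_deriv[where f = "\<lambda>t. - v t"])
    show "((\<lambda>t. - v t) has_real_derivative - (u' x - \<alpha>' x)) (at x within {a..b})" if "x \<in> {a..b}" for x
      by (rule DERIV_minus[OF dv[OF that]])
    show "0 \<le> - (u' x - \<alpha>' x)" if "t0 < x" "x < t1" for x using slope[of x] that by simp
  qed (use t0 t1 in auto)
  then show False using v0 t1(3) by simp
qed

lemma small_slope_factor:
  assumes "l < (1::real)"
  obtains \<delta> where "0 < \<delta>" "\<delta> < 1" "\<And>s. \<bar>s\<bar> \<le> \<delta> \<Longrightarrow> l \<le> (sqrt (1 - s\<^sup>2)) ^ 3"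
proof -
  have "((\<lambda>s::real. (sqrt (1 - s\<^sup>2)) ^ 3) \<longlongrightarrow> (sqrt (1 - 0\<^sup>2)) ^ 3) (at 0)"
    by (intro tendsto_intros)
  then have "eventually (\<lambda>s. l < (sqrt (1 - s\<^sup>2)) ^ 3) (at (0::real))"
    using assms by (auto dest: order_tendstoD)
  then obtain d where d: "d > 0" "\<And>s. s \<noteq> 0 \<Longrightarrow> dist s 0 < d \<Longrightarrow> l < (sqrt (1 - s\<^sup>2)) ^ 3"
    unfolding eventually_at by blast
  show thesis
  proof (rule that[of "min (d / 2) (1 / 2)"])
    fix s assume "\<bar>s\<bar> \<le> min (d / 2) (1 / 2)"
    then have "\<bar>s\<bar> < d" using d(1) by auto
    then show "l \<le> (sqrt (1 - s\<^sup>2)) ^ 3" using d(2)[of s] assms by (cases "s = 0") auto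
  qed (use d in auto)
qed

text \<open>
  The lower solution is \<open>\<alpha> = \<epsilon> e\<close> with the principal eigenfunction \<open>e\<close>. For small slopes \<open>s\<close> the
  derivative \<open>1 / (sqrt (1 - s\<^sup>2))^3\<close> of \<open>phi\<close> is close to \<open>1\<close>, and the gap between the principal
  eigenvalue and \<open>1\<close> absorbs it. The function \<open>z\<close> is the derivative of \<open>phi(\<alpha>')\<close>.
\<close>

lemma lower_solution_exists:
  assumes ab: "a < b" and \<beta>: "nonneg_continuous_on a b \<beta>" and c: "nonneg_continuous_on a b c"
    and c0: "\<exists>t\<in>{a..b}. c t \<noteq> 0" and l1: "principal_eigenvalue a b \<beta> c < 1" and m: "0 < m"
  shows "\<exists>\<alpha> \<alpha>' z.
    (\<forall>t\<in>{a..b}. (\<alpha> has_real_derivative \<alpha>' t) (at t within {a..b}) \<and>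
       ((\<lambda>t. phi (\<alpha>' t)) has_real_derivative z t) (at t within {a..b}) \<and>
       \<bar>\<alpha>' t\<bar> < 1 \<and> \<alpha> t \<le> m \<and> - z t \<le> (c t - \<beta> t) * \<alpha> t) \<and>
    (\<forall>t\<in>{a..<b}. 0 < \<alpha> t) \<and> \<alpha>' a = 0 \<and> \<alpha> b = 0"
proof -
  define l where "l = principal_eigenvalue a b \<beta> c"
  define q where "q t = l * c t - \<beta> t" for t
  have cc: "continuous_on {a..b} c" "\<And>t. t \<in> {a..b} \<Longrightarrow> 0 \<le> c t"
    and cb: "continuous_on {a..b} \<beta>" "\<And>t. t \<in> {a..b} \<Longrightarrow> 0 \<le> \<beta> t"
    using c \<beta> by (auto simp: nonneg_continuous_on_def)
  have qc: "continuous_on {a..b} q" unfolding q_def by (intro continuous_intros cc cb)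
  obtain e where e: "ivp_solution a b q 1 e" "\<And>t. t \<in> {a..<b} \<Longrightarrow> e t > 0" "e b = 0"
    using principal_eigenfunction[OF ab \<beta> c c0] unfolding q_def l_def by metis
  obtain p where p: "\<And>t. t \<in> {a..b} \<Longrightarrow> (e has_real_derivative p t) (at t within {a..b})"
    "\<And>t. t \<in> {a..b} \<Longrightarrow> (p has_real_derivative - (q t * e t)) (at t within {a..b})" "p a = 0"
    using ivp_solution_derivs[OF e(1) qc] ab by (metis less_imp_le)
  have ec: "continuous_on {a..b} e" by (rule DERIV_continuous_on) (use p(1) in auto)
  have pc: "continuous_on {a..b} p" by (rule DERIV_continuous_on) (use p(2) in auto)
  have e0: "0 \<le> e t" if "t \<in> {a..b}" for t using e(2)[of t] e(3) that by (cases "t = b") auto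
  obtain x1 where x1: "\<And>t. t \<in> {a..b} \<Longrightarrow> \<bar>p t\<bar> \<le> \<bar>p x1\<bar>"
    using continuous_attains_sup[of "{a..b}" "\<lambda>t. \<bar>p t\<bar>"] ab continuous_on_rabs[OF pc]
    by (metis atLeastAtMost_iff compact_Icc empty_iff less_imp_le order_refl)
  obtain x2 where x2: "\<And>t. t \<in> {a..b} \<Longrightarrow> \<bar>e t\<bar> \<le> \<bar>e x2\<bar>"
    using continuous_attains_sup[of "{a..b}" "\<lambda>t. \<bar>e t\<bar>"] ab continuous_on_rabs[OF ec]
    by (metis atLeastAtMost_iff compact_Icc empty_iff less_imp_le order_refl)
  define N where "N = \<bar>p x1\<bar> + \<bar>e x2\<bar> + 1"
  have N: "N > 0" "\<And>t. t \<in> {a..b} \<Longrightarrow> \<bar>p t\<bar> \<le> N" "\<And>t. t \<in> {a..b} \<Longrightarrow> e t \<le> N"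
    using x1 x2 by (auto simp: N_def add_increasing add_increasing2) fastforce+
  obtain \<delta> where \<delta>: "0 < \<delta>" "\<delta> < 1" "\<And>s. \<bar>s\<bar> \<le> \<delta> \<Longrightarrow> l \<le> (sqrt (1 - s\<^sup>2)) ^ 3"
    using small_slope_factor l1 unfolding l_def by metis
  define \<epsilon> where "\<epsilon> = min \<delta> m / N"
  have \<epsilon>: "0 < \<epsilon>" "\<epsilon> * N \<le> \<delta>" "\<epsilon> * N \<le> m" using \<delta>(1) m N(1) by (auto simp: \<epsilon>_def)
  have small: "\<bar>\<epsilon> * p t\<bar> \<le> \<delta>" if t: "t \<in> {a..b}" for t
  proof -
    have "\<epsilon> * \<bar>p t\<bar> \<le> \<epsilon> * N" using N(2)[OF t] \<epsilon>(1) by (intro mult_left_mono) auto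
    also have "\<dots> \<le> \<delta>" by (rule \<epsilon>(2))
    finally show ?thesis using \<epsilon>(1) by (simp add: abs_mult)
  qed
  define R where "R t = (sqrt (1 - (\<epsilon> * p t)\<^sup>2)) ^ 3" for t
  have R: "0 < R t" "R t \<le> 1" "l \<le> R t" if t: "t \<in> {a..b}" for t
  proof -
    have "\<bar>\<epsilon> * p t\<bar> < 1" using small[OF t] \<delta>(2) by linarith
    then show "0 < R t" using one_minus_square_pos by (simp add: R_def)
    show "R t \<le> 1" unfolding R_def by (rule power_le_one) (use one_minus_square_pos \<open>\<bar>\<epsilon> * p t\<bar> < 1\<close> in \<open>auto intro: less_imp_le\<close>)
    show "l \<le> R t" unfolding R_def by (rule \<delta>(3)[OF small[OF t]])
  qed
  show ?thesis
  proof (rule exI[of _ "\<lambda>t. \<epsilon> * e t"], rule exI[of _ "\<lambda>t. \<epsilon> * p t"],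
      rule exI[of _ "\<lambda>t. - (\<epsilon> * (q t * e t) / R t)"], intro conjI ballI)
    fix t assume t: "t \<in> {a..b}"
    show "((\<lambda>t. \<epsilon> * e t) has_real_derivative \<epsilon> * p t) (at t within {a..b})"
      by (rule DERIV_cmult[OF p(1)[OF t]])
    show lt1: "\<bar>\<epsilon> * p t\<bar> < 1" using small[OF t] \<delta>(2) by linarith
    show "((\<lambda>t. phi (\<epsilon> * p t)) has_real_derivative - (\<epsilon> * (q t * e t) / R t)) (at t within {a..b})"
      using DERIV_chain2[OF phi_has_derivative[OF lt1] DERIV_cmult[OF p(2)[OF t], of \<epsilon>]]
      by (simp add: R_def)
    have "\<epsilon> * e t \<le> \<epsilon> * N" using N(3)[OF t] \<epsilon>(1) by (intro mult_left_mono) auto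
    then show "\<epsilon> * e t \<le> m" using \<epsilon> by linarith
    have "q t \<le> R t * (c t - \<beta> t)"
    proof -
      have "l * c t \<le> R t * c t" using R(3)[OF t] cc(2)[OF t] by (rule mult_right_mono)
      moreover have "R t * \<beta> t \<le> 1 * \<beta> t" using R(2)[OF t] cb(2)[OF t] by (rule mult_right_mono)
      ultimately show ?thesis by (simp add: q_def algebra_simps)
    qed
    then have "q t / R t \<le> c t - \<beta> t" using R(1)[OF t] by (simp add: field_simps)
    then have "q t / R t * (\<epsilon> * e t) \<le> (c t - \<beta> t) * (\<epsilon> * e t)"
      using \<epsilon>(1) e0[OF t] by (intro mult_right_mono) auto
    then show "- (- (\<epsilon> * (q t * e t) / R t)) \<le> (c t - \<beta> t) * (\<epsilon> * e t)"
      by (simp add: mult.commute mult.left_commute)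
  qed (use p(3) e(2,3) \<epsilon>(1) in auto)
qed

theorem theorem3p1:
  fixes a b :: real
    and f :: "real \<Rightarrow> real \<Rightarrow> real"
    and \<beta> :: "real \<Rightarrow> real"
  assumes ab: "a < b"
    and f_cont: "continuous_on ({a..b} \<times> {0..}) (\<lambda>(t, s). f t s)"
    and f_zero: "\<forall>t\<in>{a..b}. f t 0 = 0"
    and beta: "nonneg_continuous_on a b \<beta>"
    and f_lower: "\<forall>t\<in>{a..b}. \<forall>s\<ge>0. f t s \<ge> - \<beta> t * s"
    and cond_i: "\<exists>\<sigma> b0. \<sigma> > 0 \<and> nonneg_continuous_on a b b0 \<and> (\<exists>t\<in>{a..b}. b0 t \<noteq> 0) \<and>
          principal_eigenvalue a b \<beta> b0 < 1 \<and>
          (\<forall>t\<in>{a..b}. \<forall>s\<in>{0..\<sigma>}. f t s + \<beta> t * s \<ge> b0 t * s)"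
    and cond_ii: "\<exists>\<eta> binf. \<eta> > 0 \<and> nonneg_continuous_on a b binf \<and> (\<exists>t\<in>{a..b}. binf t \<noteq> 0) \<and>
          principal_eigenvalue a b (\<lambda>t. 0) binf > 1 \<and>
          (\<forall>t\<in>{a..b}. \<forall>s\<ge>\<eta>. f t s \<le> binf t * s)"
  shows "\<exists>u. bvp_solution a b f u \<and> positive_on a b u \<and> max_norm a b (deriv_on a b u) < 1"
proof -
  obtain \<sigma> b0 where \<sigma>: "\<sigma> > 0" and b0: "nonneg_continuous_on a b b0" "\<exists>t\<in>{a..b}. b0 t \<noteq> 0"
      "principal_eigenvalue a b \<beta> b0 < 1"
    and fb0: "\<And>t s. t \<in> {a..b} \<Longrightarrow> s \<in> {0..\<sigma>} \<Longrightarrow> f t s + \<beta> t * s \<ge> b0 t * s"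
    using cond_i by blast
  define M where "M = b - a"
  have M: "M > 0" using ab by (simp add: M_def)
  have "0 < min \<sigma> M" using \<sigma> M by simp
  from lower_solution_exists[OF ab beta b0 this] obtain \<alpha> \<alpha>' z where lower:
    "(\<forall>t\<in>{a..b}. (\<alpha> has_real_derivative \<alpha>' t) (at t within {a..b}) \<and>
       ((\<lambda>t. phi (\<alpha>' t)) has_real_derivative z t) (at t within {a..b}) \<and>
       \<bar>\<alpha>' t\<bar> < 1 \<and> \<alpha> t \<le> min \<sigma> M \<and> - z t \<le> (b0 t - \<beta> t) * \<alpha> t) \<and>
    (\<forall>t\<in>{a..<b}. 0 < \<alpha> t) \<and> \<alpha>' a = 0 \<and> \<alpha> b = 0"
    by (elim exE) (rule that)
  then have \<alpha>: "\<And>t. t \<in> {a..b} \<Longrightarrow> (\<alpha> has_real_derivative \<alpha>' t) (at t within {a..b})"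
    and z: "\<And>t. t \<in> {a..b} \<Longrightarrow> ((\<lambda>t. phi (\<alpha>' t)) has_real_derivative z t) (at t within {a..b})"
    and \<alpha>1: "\<And>t. t \<in> {a..b} \<Longrightarrow> \<bar>\<alpha>' t\<bar> < 1"
    and \<alpha>le: "\<And>t. t \<in> {a..b} \<Longrightarrow> \<alpha> t \<le> min \<sigma> M"
    and zle: "\<And>t. t \<in> {a..b} \<Longrightarrow> - z t \<le> (b0 t - \<beta> t) * \<alpha> t"
    and \<alpha>pos: "\<And>t. t \<in> {a..<b} \<Longrightarrow> 0 < \<alpha> t" and bc: "\<alpha>' a = 0" "\<alpha> b = 0"
    by blast+
  have \<alpha>0: "0 \<le> \<alpha> t" if "t \<in> {a..b}" for t
    using \<alpha>pos[of t] bc(2) that by (cases "t = b") auto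
  have \<alpha>c: "continuous_on {a..b} \<alpha>" by (rule DERIV_continuous_on) (use \<alpha> in auto)
  define cut where "cut t s = min M (max (\<alpha> t) s)" for t s
  have cut: "cut t s \<in> {0..M}" if "t \<in> {a..b}" for t s
    using \<alpha>0[OF that] M by (auto simp: cut_def)
  \<comment> \<open>Truncation between the lower solution and \<open>b - a\<close>, a bound for any function with slope below
    \<open>1\<close> that vanishes at \<open>b\<close>; the truncated problem has a bounded continuous right-hand side.\<close>
  define g where "g t s = f t (cut t s)" for t s
  have g: "continuous_on ({a..b} \<times> UNIV) (\<lambda>(t, s). g t s)"
  proof -
    have "continuous_on ({a..b} \<times> UNIV) (\<lambda>x. (fst x, cut (fst x) (snd x)))"
      unfolding cut_def by (intro continuous_intros continuous_on_compose2[OF \<alpha>c]) auto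
    then have "continuous_on ({a..b} \<times> UNIV) (\<lambda>x. (\<lambda>(t, s). f t s) (fst x, cut (fst x) (snd x)))"
      by (rule continuous_on_compose2[OF f_cont]) (use cut in auto)
    then show ?thesis by (simp add: g_def case_prod_unfold)
  qed
  have "\<exists>G. \<forall>t\<in>{a..b}. \<forall>s\<in>{0..M}. \<bar>f t s\<bar> \<le> G"
  proof -
    have "compact ((\<lambda>(t, s). f t s) ` ({a..b} \<times> {0..M}))"
      by (intro compact_continuous_image continuous_on_subset[OF f_cont] compact_Times) auto
    then obtain G where "\<forall>x\<in>(\<lambda>(t, s). f t s) ` ({a..b} \<times> {0..M}). norm x \<le> G"
      using compact_imp_bounded bounded_iff by metis
    then show ?thesis by (intro exI[of _ G]) auto
  qed
  then obtain G where G: "\<And>t s. t \<in> {a..b} \<Longrightarrow> \<bar>g t s\<bar> \<le> G"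
    using cut unfolding g_def by blast
  obtain u where "continuous_on {a..b} u \<and> u b = 0 \<and>
      (\<forall>t\<in>{a..b}. u t = u a - twice_integral a phi_inv (\<lambda>r. g r (u r)) t)"
    using bounded_bvp_solvable[OF g G continuous_on_phi_inv abs_phi_inv_le ab] ..
  then have uc: "continuous_on {a..b} u" and ub: "u b = 0"
    and u_eq: "\<And>t. t \<in> {a..b} \<Longrightarrow> u t = u a - twice_integral a phi_inv (\<lambda>r. g r (u r)) t"
    by blast+
  have hc: "continuous_on {a..b} (\<lambda>r. g r (u r))" by (rule continuous_on_superposition[OF g uc])
  have sol: "bvp_solution a b g u"
    by (rule bvp_solution_of_fixed_point[OF ab hc u_eq ub]) auto
  define u' where "u' = deriv_on a b u"
  have du: "(u has_real_derivative u' t) (at t within {a..b})" if "t \<in> {a..b}" for t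
    unfolding u'_def using sol that by (intro C1_on_has_derivative) (auto simp: bvp_solution_def)
  have u'c: "continuous_on {a..b} u'"
    using sol by (simp add: u'_def bvp_solution_def C1_on_def)
  have u'1: "\<bar>u' t\<bar> < 1" if t: "t \<in> {a..b}" for t
  proof -
    have "bdd_above ((\<lambda>t. \<bar>u' t\<bar>) ` {a..b})"
      by (intro bounded_imp_bdd_above compact_imp_bounded compact_continuous_image
          continuous_on_rabs u'c compact_Icc)
    then have "\<bar>u' t\<bar> \<le> max_norm a b u'" unfolding max_norm_def by (rule cSUP_upper[OF t])
    then show ?thesis using sol by (simp add: u'_def bvp_solution_def)
  qed
  have u_le: "u t \<le> M" if t: "t \<in> {a..b}" for t
  proof -
    have "norm (u t - u b) \<le> 1 * norm (t - b)"
      by (rule field_differentiable_bound[of "{a..b}" u u'])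
        (use du u'1 t ab in \<open>auto intro: less_imp_le\<close>)
    then have "u t \<le> b - t" using ub t by auto
    then show ?thesis using t by (simp add: M_def)
  qed
  define w where "w = deriv_on a b (\<lambda>t. phi (u' t))"
  have dw: "((\<lambda>t. phi (u' t)) has_real_derivative w t) (at t within {a..b})" if "t \<in> {a..b}" for t
    unfolding w_def u'_def using sol that by (intro C1_on_has_derivative) (auto simp: bvp_solution_def)
  have \<alpha>u: "\<alpha> t \<le> u t" if t: "t \<in> {a..b}" for t
  proof (rule lower_solution_below[OF ab du \<alpha> u'1 \<alpha>1 dw z _ _ _ t])
    fix t assume t: "t \<in> {a<..<b}" and less: "u t < \<alpha> t"
    then have t': "t \<in> {a..b}" by auto
    have "g t (u t) = f t (\<alpha> t)" using less \<alpha>le[OF t'] by (simp add: g_def cut_def)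
    moreover have "- w t = g t (u t)" using sol t by (simp add: bvp_solution_def w_def u'_def)
    moreover have "b0 t * \<alpha> t \<le> f t (\<alpha> t) + \<beta> t * \<alpha> t"
      using \<alpha>0[OF t'] \<alpha>le[OF t'] by (intro fb0[OF t']) auto
    ultimately show "w t \<le> z t" using zle[OF t'] by (simp add: algebra_simps)
  next
    show "u' a = \<alpha>' a" using sol bc(1) by (simp add: bvp_solution_def u'_def)
    show "\<alpha> b \<le> u b" using bc(2) ub by simp
  qed
  have gf: "g t (u t) = f t (u t)" if "t \<in> {a..b}" for t
    using \<alpha>u[OF that] u_le[OF that] by (simp add: g_def cut_def)
  have "bvp_solution a b f u"
    by (rule bvp_solution_of_fixed_point[OF ab hc u_eq ub]) (use gf in auto)
  moreover have "positive_on a b u"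
    unfolding positive_on_def
  proof (intro conjI ballI)
    fix t assume t: "t \<in> {a..<b}"
    then show "0 < u t" using \<alpha>pos[OF t] \<alpha>u[of t] by auto
  qed (rule ub)
  ultimately show ?thesis by (auto simp: bvp_solution_def)
qed

end
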